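(* Let $G$ be a closed subgroup of $\mathrm{GL}(n,\mathbb{C})$ with Lie algebra $\mathfrak{g}\subseteq\mathbb{C}^{n\times n}$. Then the Lie exponential $\exp\colon\mathfrak{g}\to G$ is a diffeomorphism on the set \[ U = \{A\in\mathfrak{g} : |\operatorname{Im}(\lambda_i(A))| < \pi \text{ for all } i\}, \] where $\lambda_i(A)$ denote the eigenvalues of $A$.
   Context: A closed subgroup $G$ of $\mathrm{GL}(n,\mathbb{C})$ is regarded as a (real) Lie group, with Lie algebra $\mathfrak{g}=T_{\mathrm{I}}G$. For such groups the Lie exponential is the matrix exponential $\exp(A)=\sum_{k\ge0}A^k/k!$. Eigenvalues are those of $A$ as a complex $n\times n$ matrix. "Diffeomorphism on $U$" means that the restriction of $\exp$ to the open set $U\subseteq\mathfrak{g}$ is a diffeomorphism onto its image $\exp(U)$, an open subset of $G$. *)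

theory Defs
  imports "HOL-Analysis.Analysis" "HOL-Algebra.Group"
begin

text \<open>Multiplication on \<open>complex^'n^'n\<close> is componentwise in the library, so its overloaded
  \<open>^\<close> and \<open>exp\<close> are not the matrix operations; the matrix product is \<open>**\<close>.\<close>

primrec matrix_pow :: "complex^'n^'n \<Rightarrow> nat \<Rightarrow> complex^'n^'n" where
  "matrix_pow A 0 = mat 1"
| "matrix_pow A (Suc k) = A ** matrix_pow A k"

definition matrix_exp :: "complex^'n^'n \<Rightarrow> complex^'n^'n" where
  "matrix_exp A = (\<Sum>k. (1 / fact k) *\<^sub>R matrix_pow A k)"

definition eigenvalue :: "complex^'n^'n \<Rightarrow> complex \<Rightarrow> bool" where
  "eigenvalue A \<mu> \<longleftrightarrow> (\<exists>v. v \<noteq> 0 \<and> A *v v = \<mu> *s v)"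

definition GL :: "(complex^'n^'n) monoid" where
  "GL = \<lparr>carrier = {A. invertible A}, mult = (**), one = mat 1\<rparr>"

lemma group_GL: "group (GL :: (complex^'n^'n) monoid)"
proof (rule groupI)
  fix A :: "complex^'n^'n"
  assume "A \<in> carrier GL"
  then obtain B where "A ** B = mat 1" "B ** A = mat 1"
    by (auto simp: GL_def invertible_def)
  then show "\<exists>B\<in>carrier GL. B \<otimes>\<^bsub>GL\<^esub> A = \<one>\<^bsub>GL\<^esub>"
    by (auto simp: GL_def invertible_def)
next
  have "invertible (mat 1 :: complex^'n^'n)"
    unfolding invertible_def by (intro exI[of _ "mat 1"]) simp
  then show "\<one>\<^bsub>GL\<^esub> \<in> carrier (GL :: (complex^'n^'n) monoid)"
    by (simp add: GL_def)
qed (auto simp: GL_def invertible_mult matrix_mul_assoc)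

text \<open>Closedness is relative to the general linear group; \<open>G\<close> need not be closed in the
  space of all matrices.\<close>

definition closed_subgroup_GL :: "(complex^'n^'n) set \<Rightarrow> bool" where
  "closed_subgroup_GL G \<longleftrightarrow> subgroup G GL \<and> closedin (top_of_set (carrier GL)) G"

text \<open>Real differentiability classes \<open>C^k\<close> and \<open>C^\<infinity>\<close>, meant for open \<open>S\<close> only:
  \<open>C^(k+1)\<close> asks for total differentiability with every directional derivative of class \<open>C^k\<close>.\<close>

fun Ck_on :: "nat \<Rightarrow> 'a::euclidean_space set \<Rightarrow> ('a \<Rightarrow> 'b::euclidean_space) \<Rightarrow> bool" where
  "Ck_on 0 S f \<longleftrightarrow> continuous_on S f"
| "Ck_on (Suc k) S f \<longleftrightarrow>
     (\<forall>x\<in>S. f differentiable (at x)) \<and> (\<forall>v. Ck_on k S (\<lambda>x. frechet_derivative f (at x) v))"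

definition smooth_on :: "'a::euclidean_space set \<Rightarrow> ('a \<Rightarrow> 'b::euclidean_space) \<Rightarrow> bool" where
  "smooth_on S f \<longleftrightarrow> (\<forall>k. Ck_on k S f)"

text \<open>The tangent space of an embedded submanifold \<open>M\<close> at \<open>p\<close>: initial velocities of smooth curves
  in \<open>M\<close> starting at \<open>p\<close>.\<close>

definition tangent_space :: "'a::euclidean_space set \<Rightarrow> 'a \<Rightarrow> 'a set" where
  "tangent_space M p = {v. \<exists>\<gamma> \<epsilon>. 0 < \<epsilon> \<and> smooth_on {-\<epsilon><..<\<epsilon>} \<gamma> \<and> \<gamma> ` {-\<epsilon><..<\<epsilon>} \<subseteq> M \<and>
     \<gamma> (0::real) = p \<and> (\<gamma> has_vector_derivative v) (at 0)}"

definition lie_algebra :: "(complex^'n^'n) set \<Rightarrow> (complex^'n^'n) set" where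
  "lie_algebra G = tangent_space G (mat 1)"

text \<open>Smoothness between (open subsets of) embedded submanifolds of Euclidean spaces: locally,
  the map is the restriction of a smooth map on an open subset of the ambient space. Closed
  subgroups of the general linear group are embedded submanifolds of the matrix space, and this is
  smoothness for their Lie group structure.\<close>

definition smooth_map_on :: "'a::euclidean_space set \<Rightarrow> ('a \<Rightarrow> 'b::euclidean_space) \<Rightarrow> bool" where
  "smooth_map_on S f \<longleftrightarrow>
     (\<forall>x\<in>S. \<exists>W F. open W \<and> x \<in> W \<and> smooth_on W F \<and> (\<forall>y\<in>S \<inter> W. F y = f y))"

definition diffeomorphism_between ::
  "'a::euclidean_space set \<Rightarrow> 'b::euclidean_space set \<Rightarrow> ('a \<Rightarrow> 'b) \<Rightarrow> bool" where
  "diffeomorphism_between S T f \<longleftrightarrow>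
     bij_betw f S T \<and> smooth_map_on S f \<and> smooth_map_on T (inv_into S f)"

end

theory Submission
  imports Defs "HOL-Computational_Algebra.Fundamental_Theorem_Algebra"
begin

text \<open>On the strip of matrices whose eigenvalues have imaginary part in \<open>(-\<pi>, \<pi>)\<close>, the exponential has
  the left inverse \<open>log B = (\<integral> s\<in>[0,1]. (B - 1) (1 + s (B - 1))\<inverse>)\<close>: since \<open>exp (t A)\<close> has no eigenvalue
  on the closed negative real axis, the integrand is smooth, and differentiating
  \<open>t \<mapsto> log (exp (t A))\<close> gives \<open>A\<close>. This yields at once injectivity and a smooth inverse on the open
  image of the strip. The exponential itself is smooth because Duhamel's formula expresses its
  derivative as a parameter integral of products of exponentials.

  For a closed subgroup \<open>G\<close>, the Lie algebra consists of the generators of one-parameter subgroups in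
  \<open>G\<close>, and the elements of \<open>G\<close> near the identity are exponentials of small elements of it. Near
  \<open>A \<in> U\<close> the map \<open>X \<mapsto> log (exp (-A) exp X)\<close> is therefore a continuous injection of an open part of
  the Lie algebra into the Lie algebra, so invariance of domain shows that \<open>exp U\<close> is open in \<open>G\<close>.\<close>

section \<open>Functions of class \<open>C^k\<close>\<close>

text \<open>Openness of \<open>S\<close> makes derivatives at points of \<open>S\<close> depend only
  on values on \<open>S\<close>. This is how derivatives given by choice are later exchanged for
  explicit formulas valid on \<open>S\<close>.\<close>

lemma Ck_on_cong:
  assumes "open S" "\<And>x. x \<in> S \<Longrightarrow> f x = g x" "Ck_on k S f"
  shows "Ck_on k S g"
  using assms(2,3)
proof (induction k arbitrary: f g)
  case 0
  then show ?case by (simp cong: continuous_on_cong)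
next
  case (Suc k)
  have der: "(g has_derivative frechet_derivative f (at x)) (at x)" if "x \<in> S" for x
    using that Suc.prems frechet_derivative_works has_derivative_transform_within_open[OF _ assms(1)]
    by (metis Ck_on.simps(2))
  then have "frechet_derivative f (at x) = frechet_derivative g (at x)" if "x \<in> S" for x
    using that frechet_derivative_at by blast
  then have "Ck_on k S (\<lambda>x. frechet_derivative g (at x) v)" for v
    using Suc.IH[of "\<lambda>x. frechet_derivative f (at x) v"] Suc.prems(2) by simp
  with der show ?case
    unfolding Ck_on.simps differentiable_def by blast
qed

lemma Ck_on_SucI:
  assumes "open S" and "\<And>x. x \<in> S \<Longrightarrow> (f has_derivative f' x) (at x)"
    and "\<And>v. Ck_on k S (\<lambda>x. f' x v)"
  shows "Ck_on (Suc k) S f"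
proof -
  have "f' x = frechet_derivative f (at x)" if "x \<in> S" for x
    using assms(2) that frechet_derivative_at by blast
  then have "Ck_on k S (\<lambda>x. frechet_derivative f (at x) v)" for v
    using Ck_on_cong[OF assms(1) _ assms(3)] by simp
  then show ?thesis
    using assms(2) unfolding Ck_on.simps differentiable_def by blast
qed

lemma Ck_on_has_derivative:
  "Ck_on (Suc k) S f \<Longrightarrow> x \<in> S \<Longrightarrow> (f has_derivative frechet_derivative f (at x)) (at x)"
  by (simp add: frechet_derivative_works)

lemma Ck_on_SucD: "Ck_on (Suc k) S f \<Longrightarrow> Ck_on k S f"
proof (induction k arbitrary: f)
  case 0
  then show ?case
    by (simp add: continuous_at_imp_continuous_on differentiable_imp_continuous_within)
qed simp

lemma Ck_on_imp_continuous_on: "Ck_on k S f \<Longrightarrow> continuous_on S f"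
proof (induction k)
  case (Suc k)
  then show ?case using Ck_on_SucD by blast
qed simp

lemma Ck_on_const: "open S \<Longrightarrow> Ck_on k S (\<lambda>x. c)"
proof (induction k arbitrary: c)
  case (Suc k)
  then show ?case
    by (intro Ck_on_SucI[where f' = "\<lambda>x v. 0"]) auto
qed simp

lemma Ck_on_bounded_linear:
  assumes "open S" "bounded_linear f"
  shows "Ck_on k S f"
proof (cases k)
  case 0
  then show ?thesis by (simp add: assms linear_continuous_on)
next
  case (Suc k')
  then show ?thesis
    using assms
    by (simp only:) (intro Ck_on_SucI[where f' = "\<lambda>x. f"] Ck_on_const
        bounded_linear_imp_has_derivative)
qed

lemma Ck_on_add:
  "open S \<Longrightarrow> Ck_on k S f \<Longrightarrow> Ck_on k S g \<Longrightarrow> Ck_on k S (\<lambda>x. f x + g x)"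
proof (induction k arbitrary: f g)
  case 0
  then show ?case by (simp add: continuous_on_add)
next
  case (Suc k)
  show ?case
    by (rule Ck_on_SucI[OF Suc.prems(1) has_derivative_add[OF
          Ck_on_has_derivative[OF Suc.prems(2)] Ck_on_has_derivative[OF Suc.prems(3)]]])
      (use Suc in auto)
qed

lemma Ck_on_sum:
  "open S \<Longrightarrow> (\<And>i. i \<in> I \<Longrightarrow> Ck_on k S (f i)) \<Longrightarrow> Ck_on k S (\<lambda>x. \<Sum>i\<in>I. f i x)"
  by (induction I rule: infinite_finite_induct) (auto intro: Ck_on_add Ck_on_const)

text \<open>Covers scaling, inner products and matrix products at once. The product rule leaves one
  factor undifferentiated in each term; that factor is lowered to class \<open>C^k\<close> before
  the induction hypothesis applies.\<close>

lemma Ck_on_bilinear: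
  assumes "bounded_bilinear h" "open S"
  shows "Ck_on k S f \<Longrightarrow> Ck_on k S g \<Longrightarrow> Ck_on k S (\<lambda>x. h (f x) (g x))"
proof (induction k arbitrary: f g)
  case 0
  then show ?case by (simp add: bounded_bilinear.continuous_on[OF assms(1)])
next
  case (Suc k)
  show ?case
    by (rule Ck_on_SucI[OF assms(2) bounded_bilinear.FDERIV[OF assms(1)
          Ck_on_has_derivative[OF Suc.prems(1)] Ck_on_has_derivative[OF Suc.prems(2)]]],
        assumption, assumption)
      (intro Ck_on_add Suc.IH assms(2) Ck_on_SucD[OF Suc.prems(1)] Ck_on_SucD[OF Suc.prems(2)];
        use Suc.prems in simp)
qed

lemma Ck_on_minus:
  assumes "open S" "Ck_on k S f"
  shows "Ck_on k S (\<lambda>x. - f x)"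
  using Ck_on_bilinear[OF bounded_bilinear_scaleR assms(1) Ck_on_const[OF assms(1), of _ "-1"]
      assms(2)]
  by simp

lemma Ck_on_diff:
  "open S \<Longrightarrow> Ck_on k S f \<Longrightarrow> Ck_on k S g \<Longrightarrow> Ck_on k S (\<lambda>x. f x - g x)"
  using Ck_on_add[of S k f "\<lambda>x. - g x"] Ck_on_minus[of S k g] by simp

lemma Ck_on_compose:
  assumes "open S" "open T" "g ` S \<subseteq> T"
  shows "Ck_on k T f \<Longrightarrow> Ck_on k S g \<Longrightarrow> Ck_on k S (\<lambda>x. f (g x))"
proof (induction k arbitrary: f)
  case 0
  then show ?case using assms(3) by (auto intro: continuous_on_compose2)
next
  case (Suc k)
  let ?f' = "\<lambda>x. frechet_derivative f (at (g x))" and ?g' = "\<lambda>x. frechet_derivative g (at x)"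
  have f': "(f has_derivative ?f' x) (at (g x))" if "x \<in> S" for x
    using that assms(3) by (intro Ck_on_has_derivative[OF Suc.prems(1)]) auto
  \<comment> \<open>\<open>Ck_on\<close> controls derivatives only in fixed directions, whereas the
    direction \<open>?g' x v\<close> moves with \<open>x\<close>. Expanding it in the basis leaves
    fixed directions with scalar coefficients of class \<open>C^k\<close>.\<close>
  have expand: "?f' x (?g' x v) = (\<Sum>b\<in>Basis. (?g' x v \<bullet> b) *\<^sub>R ?f' x b)" if "x \<in> S" for x v
  proof -
    interpret bounded_linear "?f' x"
      using f'[OF that] by (rule has_derivative_bounded_linear)
    show ?thesis
      by (subst euclidean_representation[of "?g' x v", symmetric]) (simp add: sum scaleR)
  qed
  have "Ck_on k S (\<lambda>x. ?f' x b)" for b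
    using Suc.IH[of "\<lambda>y. frechet_derivative f (at y) b"] Suc.prems Ck_on_SucD by auto
  moreover have "Ck_on k S (\<lambda>x. ?g' x v \<bullet> b)" for v b
    using Suc.prems(2)
    by (intro Ck_on_bilinear[OF bounded_bilinear_inner] Ck_on_const assms(1)) simp
  ultimately have "Ck_on k S (\<lambda>x. ?f' x (?g' x v))" for v
    by (intro Ck_on_cong[OF assms(1) expand[symmetric]] Ck_on_sum
        Ck_on_bilinear[OF bounded_bilinear_scaleR] assms(1))
  then show ?case
    using Ck_on_SucI[OF assms(1) has_derivative_compose[OF Ck_on_has_derivative[OF Suc.prems(2)] f']]
    by blast
qed

text \<open>Differentiation under the integral sign: the derivative in direction \<open>v\<close> is
  again a parameter integral, now of the derivative of \<open>F\<close> in direction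
  \<open>(v, 0)\<close>, so the induction closes.\<close>

lemma Ck_on_integral:
  fixes F :: "'a::euclidean_space \<times> real \<Rightarrow> 'b::euclidean_space"
  assumes "open W" "W \<times> {0..1} \<subseteq> S"
  shows "Ck_on k S F \<Longrightarrow> Ck_on k W (\<lambda>x. integral {0..1} (\<lambda>s. F (x, s)))"
proof (induction k arbitrary: F)
  case 0
  have "continuous_on (W \<times> {0..1}) F"
    by (rule continuous_on_subset[OF _ assms(2)]) (use 0 in simp)
  then have "continuous_on (W \<times> cbox 0 1) (\<lambda>(x, s). F (x, s))"
    by (simp add: case_prod_unfold)
  from integral_continuous_on_param[OF this] show ?case
    by simp
next
  case (Suc k)
  let ?D = "\<lambda>p. frechet_derivative F (at p)"
  define F' where "F' x s = Blinfun (\<lambda>v. ?D (x, s) (v, 0))" for x s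
  have F': "blinfun_apply (F' x s) = (\<lambda>v. ?D (x, s) (v, 0))"
    and derF: "((\<lambda>x. F (x, s)) has_derivative blinfun_apply (F' x s)) (at x)"
    if "x \<in> W" "s \<in> {0..1}" for x s
  proof -
    have "(F has_derivative ?D (x, s)) (at (x, s))"
      using that assms(2) by (intro Ck_on_has_derivative[OF Suc.prems]) auto
    then have *: "((\<lambda>x. F (x, s)) has_derivative (\<lambda>v. ?D (x, s) (v, 0))) (at x)"
      by (rule has_derivative_compose[rotated]) (auto intro!: derivative_eq_intros)
    then show F': "blinfun_apply (F' x s) = (\<lambda>v. ?D (x, s) (v, 0))"
      unfolding F'_def by (intro bounded_linear_Blinfun_apply has_derivative_bounded_linear)
    with * show "((\<lambda>x. F (x, s)) has_derivative blinfun_apply (F' x s)) (at x)"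
      by simp
  qed
  have contD: "continuous_on (W \<times> cbox 0 1) (\<lambda>p. ?D p v)" for v
    using Suc.prems Ck_on_imp_continuous_on assms(2) continuous_on_subset
    by (metis Ck_on.simps(2) box_real(2))
  have contF': "continuous_on (W \<times> cbox 0 1) (\<lambda>(x, s). F' x s)"
    unfolding case_prod_unfold
    by (intro continuous_on_blinfun_componentwise)
      (rule continuous_on_eq[OF contD], auto simp: F')
  have contF: "continuous_on (W \<times> cbox 0 1) F"
    using Suc.prems Ck_on_imp_continuous_on assms(2) continuous_on_subset
    by (metis box_real(2))
  have "((\<lambda>x. integral {0..1} (\<lambda>s. F (x, s))) has_derivative
      (\<lambda>v. integral {0..1} (\<lambda>s. ?D (x, s) (v, 0)))) (at x)" if x: "x \<in> W" for x
  proof -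
    obtain e where e: "e > 0" "ball x e \<subseteq> W"
      using assms(1) x openE by blast
    \<comment> \<open>The Leibniz rule works on convex sets, so it is applied on a ball around
      \<open>x\<close>; as the ball is open, the restriction to it is dropped at the end.\<close>
    have "((\<lambda>x. integral (cbox 0 1) (\<lambda>s. F (x, s))) has_derivative
        blinfun_apply (integral (cbox 0 1) (F' x))) (at x within ball x e)"
    proof (rule leibniz_rule)
      show "((\<lambda>x. F (x, s)) has_derivative blinfun_apply (F' y s)) (at y within ball x e)"
        if "y \<in> ball x e" "s \<in> cbox 0 1" for y s
        by (rule has_derivative_at_withinI, rule derF) (use that e in auto)
      show "(\<lambda>s. F (y, s)) integrable_on cbox 0 1" if "y \<in> ball x e" for y
        using that e by (intro integrable_continuous continuous_on_compose2[OF contF])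
          (auto intro!: continuous_intros)
      show "continuous_on (ball x e \<times> cbox 0 1) (\<lambda>(x, s). F' x s)"
        by (rule continuous_on_subset[OF contF']) (use e in auto)
    qed (use e in simp_all)
    moreover have "blinfun_apply (integral (cbox 0 1) (F' x)) v
        = integral {0..1} (\<lambda>s. ?D (x, s) (v, 0))" for v
    proof -
      have "continuous_on (cbox 0 1) (\<lambda>s. case (x, s) of (x, s) \<Rightarrow> F' x s)"
        by (rule continuous_on_compose2[OF contF']) (use x in \<open>auto intro!: continuous_intros\<close>)
      then have "continuous_on (cbox 0 1) (F' x)"
        by simp
      then have "F' x integrable_on cbox 0 1"
        by (rule integrable_continuous)
      then have "blinfun_apply (integral (cbox 0 1) (F' x)) v
          = integral (cbox 0 1) (\<lambda>s. blinfun_apply (F' x s) v)"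
        by (rule blinfun_apply_integral)
      also have "\<dots> = integral (cbox 0 1) (\<lambda>s. ?D (x, s) (v, 0))"
        by (rule integral_cong) (simp add: F'[OF x])
      finally show ?thesis
        by simp
    qed
    then have "blinfun_apply (integral (cbox 0 1) (F' x))
        = (\<lambda>v. integral {0..1} (\<lambda>s. ?D (x, s) (v, 0)))"
      by (rule ext)
    ultimately have "((\<lambda>x. integral {0..1} (\<lambda>s. F (x, s))) has_derivative
        (\<lambda>v. integral {0..1} (\<lambda>s. ?D (x, s) (v, 0)))) (at x within ball x e)"
      by (simp only: box_real)
    then show ?thesis
      using e(1) by (simp only: at_within_open[of x "ball x e"] open_ball centre_in_ball)
  qed
  moreover have "Ck_on k W (\<lambda>x. integral {0..1} (\<lambda>s. ?D (x, s) (v, 0)))" for v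
    using Suc.IH[of "\<lambda>p. ?D p (v, 0)"] Suc.prems by simp
  ultimately show ?case
    by (rule Ck_on_SucI[OF assms(1)])
qed

section \<open>Matrix inversion\<close>

interpretation matrix_mult: bounded_bilinear
  "(**) :: complex^'n^'n \<Rightarrow> complex^'n^'n \<Rightarrow> complex^'n^'n"
  unfolding bilinear_conv_bounded_bilinear[symmetric] bilinear_def
  by (intro conjI allI linearI)
    (simp_all add: matrix_matrix_mult_def vec_eq_iff algebra_simps sum.distrib scaleR_sum_right)

interpretation matrix_vector_mult: bounded_bilinear
  "(*v) :: complex^'n^'n \<Rightarrow> complex^'n \<Rightarrow> complex^'n"
  unfolding bilinear_conv_bounded_bilinear[symmetric] bilinear_def
  by (intro conjI allI linearI)
    (simp_all add: matrix_vector_mult_def vec_eq_iff algebra_simps sum.distrib scaleR_sum_right)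

lemma matrix_inv_right: "invertible A \<Longrightarrow> A ** matrix_inv A = mat 1"
  and matrix_inv_left: "invertible A \<Longrightarrow> matrix_inv A ** A = mat 1"
  unfolding invertible_def matrix_inv_def by (metis (mono_tags, lifting) someI_ex)+

lemma matrix_inv_commute:
  fixes A C :: "complex^'n^'n"
  assumes "invertible A" "C ** A = A ** C"
  shows "C ** matrix_inv A = matrix_inv A ** C"
  by (metis assms matrix_inv_left matrix_inv_right matrix_mul_assoc matrix_mul_lid matrix_mul_rid)

lemma open_invertible: "open {A :: complex^'n^'n. invertible A}"
proof -
  have "continuous_on UNIV (det :: complex^'n^'n \<Rightarrow> complex)"
    unfolding det_def by (intro continuous_intros)
  then have "open (det -` (- {0}) :: (complex^'n^'n) set)"
    by (intro open_vimage) auto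
  then show ?thesis
    by (simp add: invertible_det_nz vimage_def)
qed

text \<open>The resolvent identity, from which both continuity and the derivative of inversion are
  read off.\<close>

lemma matrix_inv_diff:
  fixes A B :: "complex^'n^'n"
  assumes "invertible A" "invertible B"
  shows "matrix_inv B - matrix_inv A = - (matrix_inv B ** (B - A) ** matrix_inv A)"
  using assms by (simp add: matrix_mult.diff_right matrix_mult.diff_left matrix_inv_left
      matrix_inv_right flip: matrix_mul_assoc)

lemma isCont_matrix_inv:
  fixes A :: "complex^'n^'n"
  assumes A: "invertible A"
  shows "isCont matrix_inv A"
proof -
  obtain K where K: "K > 0"
    "\<And>(X :: complex^'n^'n) (Y :: complex^'n^'n). norm (X ** Y) \<le> norm X * norm Y * K"
    using matrix_mult.pos_bounded[where 'n = 'n] by blast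
  define r where "r = norm (matrix_inv A)"
  have ev_inv: "\<forall>\<^sub>F B in at A. invertible B"
    using eventually_at_in_open'[OF open_invertible, of A] A by simp
  have "((\<lambda>B. norm (B - A) * r * K\<^sup>2) \<longlongrightarrow> norm (A - A) * r * K\<^sup>2) (at A)"
    by (intro tendsto_intros)
  \<comment> \<open>With this factor below \<open>1 / 2\<close>, the resolvent identity bounds the
    difference of the inverses by half of \<open>norm (matrix_inv B)\<close>. Absorbing that half
    gives \<open>norm (matrix_inv B) \<le> 2 * r\<close> near \<open>A\<close>.\<close>
  then have ev_small: "\<forall>\<^sub>F B in at A. norm (B - A) * r * K\<^sup>2 < 1 / 2"
    by (rule order_tendstoD) simp
  have bound: "\<forall>\<^sub>F B in at A. norm (matrix_inv B - matrix_inv A) \<le> 2 * r\<^sup>2 * K\<^sup>2 * norm (B - A)"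
    using ev_inv ev_small
  proof eventually_elim
    case (elim B)
    have le: "norm (matrix_inv B - matrix_inv A) \<le> norm (matrix_inv B) * (norm (B - A) * r * K\<^sup>2)"
    proof -
      have "norm (matrix_inv B ** (B - A) ** matrix_inv A)
          \<le> norm (matrix_inv B ** (B - A)) * r * K"
        unfolding r_def by (rule K)
      also have "\<dots> \<le> (norm (matrix_inv B) * norm (B - A) * K) * r * K"
        using K by (intro mult_right_mono K) (simp_all add: r_def)
      finally show ?thesis
        by (simp add: matrix_inv_diff[OF A elim(1)] power2_eq_square algebra_simps)
    qed
    also have "\<dots> \<le> norm (matrix_inv B) * (1 / 2)"
      using elim(2) by (intro mult_left_mono) auto
    finally have "norm (matrix_inv B) \<le> 2 * r"
      using norm_triangle_sub[of "matrix_inv B" "matrix_inv A"] by (simp add: r_def)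
    then have "norm (matrix_inv B) * (norm (B - A) * r * K\<^sup>2) \<le> 2 * r * (norm (B - A) * r * K\<^sup>2)"
      by (intro mult_right_mono) (auto simp: r_def)
    with le show ?case
      by (simp add: power2_eq_square algebra_simps)
  qed
  have "((\<lambda>B. 2 * r\<^sup>2 * K\<^sup>2 * norm (B - A)) \<longlongrightarrow> 2 * r\<^sup>2 * K\<^sup>2 * norm (A - A)) (at A)"
    by (intro tendsto_intros)
  then have "((\<lambda>B. matrix_inv B - matrix_inv A) \<longlongrightarrow> 0) (at A)"
    by (intro Lim_null_comparison[OF bound]) simp
  then show ?thesis
    unfolding isCont_def by (rule LIM_zero_cancel)
qed

text \<open>By the resolvent identity the remainder is
  \<open>- ((matrix_inv B - ?R) ** (B - A) ** ?R)\<close>. Divided by \<open>norm (B - A)\<close> it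
  is at most a constant times \<open>norm (matrix_inv B - ?R)\<close>, which tends to 0 by
  continuity.\<close>

lemma has_derivative_matrix_inv:
  fixes A :: "complex^'n^'n"
  assumes A: "invertible A"
  shows "(matrix_inv has_derivative (\<lambda>H. - (matrix_inv A ** H ** matrix_inv A))) (at A)"
proof -
  let ?R = "matrix_inv A"
  obtain K where K: "K > 0"
    "\<And>(X :: complex^'n^'n) (Y :: complex^'n^'n). norm (X ** Y) \<le> norm X * norm Y * K"
    using matrix_mult.pos_bounded[where 'n = 'n] by blast
  have ev_inv: "\<forall>\<^sub>F B in at A. invertible B"
    using eventually_at_in_open'[OF open_invertible, of A] A by simp
  have bound: "\<forall>\<^sub>F B in at A. norm ((matrix_inv B - ?R - - (?R ** (B - A) ** ?R)) /\<^sub>R norm (B - A))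
      \<le> norm (matrix_inv B - ?R) * (K * norm ?R * K)"
    using ev_inv eventually_neq_at_within[of A A]
  proof eventually_elim
    case (elim B)
    have "norm ((matrix_inv B - ?R) ** (B - A) ** ?R)
        \<le> norm ((matrix_inv B - ?R) ** (B - A)) * norm ?R * K"
      by (rule K)
    also have "\<dots> \<le> (norm (matrix_inv B - ?R) * norm (B - A) * K) * norm ?R * K"
      using K by (intro mult_right_mono K) simp_all
    finally have "norm ((matrix_inv B - ?R) ** (B - A) ** ?R)
        \<le> (norm (matrix_inv B - ?R) * (K * norm ?R * K)) * norm (B - A)"
      by (simp add: algebra_simps)
    moreover have "matrix_inv B - ?R - - (?R ** (B - A) ** ?R) = - ((matrix_inv B - ?R) ** (B - A) ** ?R)"
      unfolding matrix_mult.diff_left by (simp add: matrix_inv_diff[OF A elim(1)])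
    ultimately show ?case
      using elim(2) by (simp add: divide_simps)
  qed
  have "((\<lambda>B. norm (matrix_inv B - ?R) * (K * norm ?R * K))
      \<longlongrightarrow> norm (?R - ?R) * (K * norm ?R * K)) (at A)"
    using isCont_matrix_inv[OF A] unfolding isCont_def by (intro tendsto_intros)
  then have "((\<lambda>B. (matrix_inv B - ?R - - (?R ** (B - A) ** ?R)) /\<^sub>R norm (B - A)) \<longlongrightarrow> 0) (at A)"
    by (intro Lim_null_comparison[OF bound]) simp
  moreover have "bounded_linear (\<lambda>H. - (?R ** H ** ?R))"
    by (rule bounded_linear_minus[OF bounded_linear_compose[OF matrix_mult.bounded_linear_left
            matrix_mult.bounded_linear_right]])
  ultimately show ?thesis
    by (simp add: has_derivative_def)
qed

text \<open>Bootstrapping: the derivative is a product of the derivative of \<open>f\<close> with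
  the inverse itself, which is already of class \<open>C^k\<close> by the induction
  hypothesis.\<close>

lemma Ck_on_matrix_inv:
  fixes f :: "'a::euclidean_space \<Rightarrow> complex^'n^'n"
  assumes "open S" "\<And>x. x \<in> S \<Longrightarrow> invertible (f x)"
  shows "Ck_on k S f \<Longrightarrow> Ck_on k S (\<lambda>x. matrix_inv (f x))"
proof (induction k)
  case 0
  then show ?case
    using assms by (simp add: continuous_on_eq_continuous_at isCont_o2[OF _ isCont_matrix_inv])
next
  case (Suc k)
  have inv: "Ck_on k S (\<lambda>x. matrix_inv (f x))"
    using Suc Ck_on_SucD by blast
  show ?case
  proof (rule Ck_on_SucI[OF assms(1)])
    show "((\<lambda>x. matrix_inv (f x)) has_derivative
        (\<lambda>v. - (matrix_inv (f x) ** frechet_derivative f (at x) v ** matrix_inv (f x)))) (at x)"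
      if "x \<in> S" for x
      by (rule has_derivative_compose[OF Ck_on_has_derivative[OF Suc.prems that]
            has_derivative_matrix_inv[OF assms(2)[OF that]]])
    show "Ck_on k S (\<lambda>x. - (matrix_inv (f x) ** frechet_derivative f (at x) v ** matrix_inv (f x)))"
      for v
      by (intro Ck_on_minus inv assms(1) Ck_on_bilinear[OF matrix_mult.bounded_bilinear_axioms])
        (use Suc.prems in simp)
  qed
qed

section \<open>The matrix exponential\<close>

lemma matrix_pow_scaleR: "matrix_pow (t *\<^sub>R A) k = t ^ k *\<^sub>R matrix_pow A k"
  by (induction k) (simp_all add: matrix_mult.scaleR_left matrix_mult.scaleR_right)

lemma matrix_pow_commute: "C ** A = A ** C \<Longrightarrow> C ** matrix_pow A k = matrix_pow A k ** C"
  by (induction k) (simp, metis matrix_mul_assoc matrix_pow.simps(2))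

text \<open>Comparison with the scalar exponential series. \<open>K\<close> comes from boundedness
  of the matrix product, and \<open>c\<close> absorbs the norm of the identity in the zeroth
  power.\<close>

lemma matrix_exp_bound:
  obtains c K where "c > 0" "K > 0"
    "\<And>A :: complex^'n^'n. summable (\<lambda>k. norm ((1 / fact k) *\<^sub>R matrix_pow A k))"
    "\<And>A :: complex^'n^'n. norm (matrix_exp A) \<le> c * exp (K * norm A)"
proof -
  obtain K where K: "K > 0"
    "\<And>(X :: complex^'n^'n) (Y :: complex^'n^'n). norm (X ** Y) \<le> norm X * norm Y * K"
    using matrix_mult.pos_bounded[where 'n = 'n] by blast
  define c where "c = norm (mat 1 :: complex^'n^'n) + 1"
  have c: "c > 0"
    by (simp add: c_def add_nonneg_pos)
  have pow: "norm (matrix_pow A k) \<le> c * (K * norm A) ^ k" for A :: "complex^'n^'n" and k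
  proof (induction k)
    case (Suc k)
    have "norm (A ** matrix_pow A k) \<le> norm A * norm (matrix_pow A k) * K"
      by (rule K)
    also have "\<dots> \<le> norm A * (c * (K * norm A) ^ k) * K"
      using Suc K by (intro mult_right_mono mult_left_mono) auto
    finally show ?case
      by (simp add: algebra_simps)
  qed (simp add: c_def)
  have le: "norm ((1 / fact k) *\<^sub>R matrix_pow A k) \<le> c * ((K * norm A) ^ k /\<^sub>R fact k)"
    for A :: "complex^'n^'n" and k
    using mult_left_mono[OF pow[of A k], of "1 / fact k"] by (simp add: field_simps)
  have sm: "summable (\<lambda>k. c * ((K * norm A) ^ k /\<^sub>R fact k))" for A :: "complex^'n^'n"
    by (intro summable_mult summable_exp_generic)
  show ?thesis
  proof
    show "summable (\<lambda>k. norm ((1 / fact k) *\<^sub>R matrix_pow A k))" for A :: "complex^'n^'n"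
      by (rule summable_comparison_test'[OF sm]) (use le in simp)
    show "norm (matrix_exp A) \<le> c * exp (K * norm A)" for A :: "complex^'n^'n"
      unfolding matrix_exp_def exp_def suminf_mult[OF summable_exp_generic, symmetric]
      by (rule norm_suminf_le[OF le sm])
  qed (simp_all add: c K)
qed

lemma sums_matrix_exp: "(\<lambda>k. (1 / fact k) *\<^sub>R matrix_pow A k) sums matrix_exp A"
  unfolding matrix_exp_def by (rule matrix_exp_bound) (rule summable_sums[OF summable_norm_cancel])

lemma matrix_exp_0 [simp]: "matrix_exp 0 = mat 1"
proof -
  have "(\<lambda>k. (1 / fact k) *\<^sub>R matrix_pow (0 :: complex^'n^'n) k) sums
      (\<Sum>k\<in>{0}. (1 / fact k) *\<^sub>R matrix_pow 0 k)"
  proof (rule sums_finite)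
    show "(1 / fact k) *\<^sub>R matrix_pow (0 :: complex^'n^'n) k = 0" if "k \<notin> {0}" for k
      using that by (cases k) (simp_all add: matrix_mult.zero_left)
  qed simp
  then show ?thesis
    using sums_matrix_exp sums_unique2 by fastforce
qed

lemma matrix_exp_commute:
  assumes "C ** A = A ** C"
  shows "C ** matrix_exp A = matrix_exp A ** C"
proof -
  have "(\<lambda>k. C ** ((1 / fact k) *\<^sub>R matrix_pow A k)) sums (C ** matrix_exp A)"
    by (rule bounded_linear.sums[OF matrix_mult.bounded_linear_right sums_matrix_exp])
  moreover have "(\<lambda>k. ((1 / fact k) *\<^sub>R matrix_pow A k) ** C) sums (matrix_exp A ** C)"
    by (rule bounded_linear.sums[OF matrix_mult.bounded_linear_left sums_matrix_exp])
  ultimately show ?thesis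
    using matrix_pow_commute[OF assms]
    by (simp add: matrix_mult.scaleR_left matrix_mult.scaleR_right sums_unique2)
qed

lemma matrix_exp_eigenvector:
  assumes "A *v v = \<mu> *s v"
  shows "matrix_exp A *v v = exp \<mu> *s v"
proof -
  have pow: "matrix_pow A k *v v = \<mu> ^ k *s v" for k
    by (induction k) (simp_all add: assms vec.scale algebra_simps flip: matrix_vector_mul_assoc)
  have "(\<lambda>k. ((1 / fact k) *\<^sub>R matrix_pow A k) *v v) sums (matrix_exp A *v v)"
    by (rule bounded_linear.sums[OF matrix_vector_mult.bounded_linear_left sums_matrix_exp])
  moreover have "bounded_linear (\<lambda>z. z *s v)"
    by (intro linear_conv_bounded_linear[THEN iffD1] linearI)
      (simp_all add: vec_eq_iff algebra_simps)
  then have "(\<lambda>k. (\<mu> ^ k /\<^sub>R fact k) *s v) sums (exp \<mu> *s v)"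
    by (rule bounded_linear.sums[OF _ exp_converges])
  moreover have "((1 / fact k) *\<^sub>R matrix_pow A k) *v v = (\<mu> ^ k /\<^sub>R fact k) *s v" for k
    by (simp add: matrix_vector_mult.scaleR_left pow vec_eq_iff divide_inverse)
  ultimately show ?thesis
    using sums_unique2 by fastforce
qed

section \<open>Derivatives and smoothness of the exponential\<close>

lemma has_vector_derivative_vec:
  fixes f :: "real \<Rightarrow> 'a::real_normed_vector^'n"
  assumes "\<And>i. ((\<lambda>t. f t $ i) has_vector_derivative f' $ i) (at t)"
  shows "(f has_vector_derivative f') (at t)"
  using assms unfolding has_vector_derivative_def has_derivative_def
  by (auto intro!: vec_tendstoI bounded_linear_scaleR_left)

text \<open>Each matrix entry is the value at a real point of an everywhere convergent complex power
  series, which may be differentiated term by term.\<close>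

lemma has_vector_derivative_matrix_exp:
  fixes A :: "complex^'n^'n"
  shows "((\<lambda>t. matrix_exp (t *\<^sub>R A)) has_vector_derivative A ** matrix_exp (t *\<^sub>R A)) (at t)"
proof (intro has_vector_derivative_vec)
  fix i j
  \<comment> \<open>These are the power series coefficients of the entry of
    \<open>B ** matrix_exp (t *\<^sub>R A)\<close>. The choice \<open>B = mat 1\<close> gives the
    function, the choice \<open>B = A\<close> its claimed derivative.\<close>
  define c where "c B k = (1 / fact k) *\<^sub>R (B ** matrix_pow A k) $ i $ j"
    for B :: "complex^'n^'n" and k
  have lin: "bounded_linear (\<lambda>X. (B ** X) $ i $ j)" for B :: "complex^'n^'n"
    by (intro bounded_linear_compose[OF bounded_linear_vec_nth] matrix_mult.bounded_linear_right)
  have sums: "(\<lambda>k. c B k * of_real t ^ k) sums (B ** matrix_exp (t *\<^sub>R A)) $ i $ j" for B t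
  proof -
    have "(B ** ((1 / fact k) *\<^sub>R matrix_pow (t *\<^sub>R A) k)) $ i $ j = c B k * of_real t ^ k" for k
      by (simp only: c_def matrix_pow_scaleR matrix_mult.scaleR_right vector_scaleR_component)
        (simp add: scaleR_conv_of_real)
    then show ?thesis
      using bounded_linear.sums[OF lin sums_matrix_exp, of B "t *\<^sub>R A"] by simp
  qed
  have sm: "summable (\<lambda>k. c (mat 1) k * z ^ k)" for z :: complex
  proof -
    have *: "summable (\<lambda>k. norm ((1 / fact k) *\<^sub>R matrix_pow (norm z *\<^sub>R A) k))"
      by (rule matrix_exp_bound)
    have "norm (c (mat 1) k * z ^ k) \<le> norm ((1 / fact k) *\<^sub>R matrix_pow (norm z *\<^sub>R A) k)" for k
    proof -
      have "norm (matrix_pow A k $ i $ j) \<le> norm (matrix_pow A k)"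
        by (rule order_trans[OF Finite_Cartesian_Product.norm_nth_le
              Finite_Cartesian_Product.norm_nth_le])
      then show ?thesis
        by (simp add: c_def matrix_pow_scaleR norm_mult norm_power divide_right_mono
            mult_left_mono mult.commute)
    qed
    then show ?thesis
      by (intro summable_comparison_test'[OF *]) simp
  qed
  \<comment> \<open>The factor \<open>Suc k\<close> from differentiation cancels against
    \<open>fact (Suc k)\<close>, and one factor \<open>A\<close> splits off the power.\<close>
  have dc: "diffs (c (mat 1)) = c A"
    by (rule ext) (simp add: diffs_def c_def scaleR_conv_of_real field_simps del: of_nat_Suc)
  have "((\<lambda>z. \<Sum>k. c (mat 1) k * z ^ k) has_field_derivative
      (\<Sum>k. diffs (c (mat 1)) k * of_real t ^ k)) (at (of_real t))"
    by (rule termdiffs_strong_converges_everywhere[OF sm])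
  from has_vector_derivative_real_field[OF this]
  show "((\<lambda>t. matrix_exp (t *\<^sub>R A) $ i $ j) has_vector_derivative
      (A ** matrix_exp (t *\<^sub>R A)) $ i $ j) (at t)"
    using sums[THEN sums_unique, symmetric] by (simp add: dc flip: sums)
qed

text \<open>Differentiating the two factors puts \<open>B\<close> and \<open>- A\<close> in the
  middle of the product. For \<open>B = A\<close> the curve is constant, which yields the addition
  law; \<open>c = 1\<close> yields Duhamel's formula.\<close>

lemma has_vector_derivative_matrix_exp_mult:
  "((\<lambda>s. matrix_exp (s *\<^sub>R B) ** matrix_exp ((c - s) *\<^sub>R A)) has_vector_derivative
    matrix_exp (s *\<^sub>R B) ** (B - A) ** matrix_exp ((c - s) *\<^sub>R A)) (at s)"
proof -
  have "((\<lambda>s. c - s) has_vector_derivative - 1) (at s)"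
    by (auto intro!: derivative_eq_intros simp: has_vector_derivative_def)
  then have "((\<lambda>s. matrix_exp ((c - s) *\<^sub>R A)) has_vector_derivative
      - (A ** matrix_exp ((c - s) *\<^sub>R A))) (at s)"
    using vector_diff_chain_at[OF _ has_vector_derivative_matrix_exp] by (fastforce simp: o_def)
  from bounded_bilinear.has_vector_derivative[OF matrix_mult.bounded_bilinear_axioms
      has_vector_derivative_matrix_exp this]
  have "((\<lambda>s. matrix_exp (s *\<^sub>R B) ** matrix_exp ((c - s) *\<^sub>R A)) has_vector_derivative
    matrix_exp (s *\<^sub>R B) ** - (A ** matrix_exp ((c - s) *\<^sub>R A)) +
    B ** matrix_exp (s *\<^sub>R B) ** matrix_exp ((c - s) *\<^sub>R A)) (at s)" .
  moreover have "B ** matrix_exp (s *\<^sub>R B) = matrix_exp (s *\<^sub>R B) ** B"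
    by (rule matrix_exp_commute) (simp add: matrix_mult.scaleR_left matrix_mult.scaleR_right)
  ultimately show ?thesis
    by (simp add: matrix_mult.diff_left matrix_mult.diff_right matrix_mult.minus_right
        matrix_mul_assoc)
qed

lemma matrix_exp_add_scaleR:
  "matrix_exp ((s + t) *\<^sub>R A) = matrix_exp (s *\<^sub>R A) ** matrix_exp (t *\<^sub>R A)"
proof -
  \<comment> \<open>The two sides of the claim are the values of this constant curve at
    \<open>u = 0\<close> and \<open>u = s\<close>.\<close>
  let ?f = "\<lambda>u. matrix_exp (u *\<^sub>R A) ** matrix_exp ((s + t - u) *\<^sub>R A)"
  have "(?f has_vector_derivative 0) (at u within UNIV)" for u
    using has_vector_derivative_matrix_exp_mult[of A "s + t" A u]
    by (simp add: matrix_mult.zero_left matrix_mult.zero_right)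
  then obtain C where "\<And>u. ?f u = C"
    by (rule has_vector_derivative_zero_constant[of UNIV ?f, OF convex_UNIV]) auto
  from this[of 0] this[of s] show ?thesis
    by simp
qed

lemma matrix_exp_minus:
  "matrix_exp A ** matrix_exp (- A) = mat 1" "matrix_exp (- A) ** matrix_exp A = mat 1"
  using matrix_exp_add_scaleR[of 1 "-1" A] matrix_exp_add_scaleR[of "-1" 1 A] by simp_all

lemma invertible_matrix_exp: "invertible (matrix_exp A)"
  unfolding invertible_def using matrix_exp_minus by blast

lemma matrix_exp_duhamel:
  "((\<lambda>s. matrix_exp (s *\<^sub>R B) ** (B - A) ** matrix_exp ((1 - s) *\<^sub>R A))
    has_integral (matrix_exp B - matrix_exp A)) {0..1}"
proof -
  have "((\<lambda>s. matrix_exp (s *\<^sub>R B) ** (B - A) ** matrix_exp ((1 - s) *\<^sub>R A)) has_integral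
      (matrix_exp (1 *\<^sub>R B) ** matrix_exp ((1 - 1) *\<^sub>R A)
        - matrix_exp (0 *\<^sub>R B) ** matrix_exp ((1 - 0) *\<^sub>R A))) {0..1}"
    by (intro fundamental_theorem_of_calculus
        has_vector_derivative_at_within[OF has_vector_derivative_matrix_exp_mult]) simp
  then show ?thesis
    by simp
qed

text \<open>On the ball of radius \<open>r\<close> both exponentials in Duhamel's integrand are
  bounded by \<open>m\<close>, and the middle factor is \<open>B - A\<close>.\<close>

lemma matrix_exp_lipschitz:
  obtains M where "M \<ge> 0"
    "\<And>A (B :: complex^'n^'n). norm A \<le> r \<Longrightarrow> norm B \<le> r \<Longrightarrow>
      norm (matrix_exp B - matrix_exp A) \<le> M * norm (B - A)"
proof -
  obtain K where K: "K > 0"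
    "\<And>(X :: complex^'n^'n) (Y :: complex^'n^'n). norm (X ** Y) \<le> norm X * norm Y * K"
    using matrix_mult.pos_bounded[where 'n = 'n] by blast
  obtain c L where cL: "c > 0" "L > 0"
    and exp_le: "\<And>A :: complex^'n^'n. norm (matrix_exp A) \<le> c * exp (L * norm A)"
    using matrix_exp_bound[where 'n = 'n] by metis
  define m where "m = c * exp (L * r)"
  have m: "norm (matrix_exp (s *\<^sub>R A)) \<le> m" if "norm A \<le> r" "s \<in> {0..1}"
    for A :: "complex^'n^'n" and s
  proof -
    have "norm (s *\<^sub>R A) \<le> r"
      using mult_mono[of s 1 "norm A" r] that by auto
    then have "c * exp (L * norm (s *\<^sub>R A)) \<le> m"
      unfolding m_def using cL by simp
    then show ?thesis
      using exp_le order_trans by blast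
  qed
  have m0: "m \<ge> 0"
    using cL by (simp add: m_def)
  show ?thesis
  proof
    show "m * K * m * K \<ge> 0"
      using m0 K by simp
    fix A B :: "complex^'n^'n"
    assume AB: "norm A \<le> r" "norm B \<le> r"
    have "norm (matrix_exp (s *\<^sub>R B) ** (B - A) ** matrix_exp ((1 - s) *\<^sub>R A))
        \<le> m * K * m * K * norm (B - A)" if s: "s \<in> cbox 0 1" for s
    proof -
      have "norm (matrix_exp (s *\<^sub>R B) ** (B - A) ** matrix_exp ((1 - s) *\<^sub>R A))
          \<le> norm (matrix_exp (s *\<^sub>R B) ** (B - A)) * norm (matrix_exp ((1 - s) *\<^sub>R A)) * K"
        by (rule K)
      also have "\<dots> \<le> (norm (matrix_exp (s *\<^sub>R B)) * norm (B - A) * K) * m * K"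
        using K s m0 AB by (intro mult_right_mono mult_mono m K) auto
      also have "\<dots> \<le> (m * norm (B - A) * K) * m * K"
        using K s m0 AB by (intro mult_right_mono m) auto
      finally show ?thesis
        by (simp add: algebra_simps)
    qed
    then show "norm (matrix_exp B - matrix_exp A) \<le> m * K * m * K * norm (B - A)"
      using has_integral_bound[OF _ matrix_exp_duhamel[of B A, folded box_real(2)]] m0 K
      by fastforce
  qed
qed

lemma isCont_matrix_exp:
  fixes A :: "complex^'n^'n"
  shows "isCont matrix_exp A"
proof -
  obtain M where M: "\<And>X Y :: complex^'n^'n. norm X \<le> norm A + 1 \<Longrightarrow> norm Y \<le> norm A + 1 \<Longrightarrow>
      norm (matrix_exp Y - matrix_exp X) \<le> M * norm (Y - X)"
    using matrix_exp_lipschitz by blast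
  have "\<forall>\<^sub>F B in at A. B \<in> ball A 1"
    by (rule eventually_at_in_open') auto
  then have bound: "\<forall>\<^sub>F B in at A. norm (matrix_exp B - matrix_exp A) \<le> M * norm (B - A)"
  proof eventually_elim
    case (elim B)
    then have "norm B \<le> norm A + 1"
      using norm_triangle_ineq2[of B A] by (simp add: dist_norm norm_minus_commute)
    then show ?case
      by (intro M) auto
  qed
  have "((\<lambda>B. M * norm (B - A)) \<longlongrightarrow> M * norm (A - A)) (at A)"
    by (intro tendsto_intros)
  then have "((\<lambda>B. matrix_exp B - matrix_exp A) \<longlongrightarrow> 0) (at A)"
    by (intro Lim_null_comparison[OF bound]) simp
  then show ?thesis
    unfolding isCont_def by (rule LIM_zero_cancel)
qed

lemma continuous_on_matrix_exp [continuous_intros]: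
  "continuous_on S f \<Longrightarrow> continuous_on S (\<lambda>x. matrix_exp (f x))"
  by (rule continuous_on_compose2[of UNIV matrix_exp])
    (simp_all add: continuous_on_eq_continuous_at isCont_matrix_exp)

lemmas continuous_on_matrix_mult [continuous_intros] = matrix_mult.continuous_on

text \<open>The derivative is Duhamel's integral with the left exponential frozen at
  \<open>A\<close>. The error contains both \<open>B - A\<close> and the difference of
  \<open>matrix_exp (s *\<^sub>R B)\<close> and \<open>matrix_exp (s *\<^sub>R A)\<close>, so the
  Lipschitz bound makes it quadratic in \<open>norm (B - A)\<close>.\<close>

lemma has_derivative_matrix_exp:
  fixes A :: "complex^'n^'n"
  shows "(matrix_exp has_derivative
    (\<lambda>V. integral {0..1} (\<lambda>s. matrix_exp (s *\<^sub>R A) ** V ** matrix_exp ((1 - s) *\<^sub>R A)))) (at A)"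
    (is "(_ has_derivative ?D) _")
proof -
  let ?F = "\<lambda>(B :: complex^'n^'n) (V :: complex^'n^'n) s. matrix_exp (s *\<^sub>R B) ** V ** matrix_exp ((1 - s) *\<^sub>R A)"
  obtain K where K: "K > 0"
    "\<And>(X :: complex^'n^'n) (Y :: complex^'n^'n). norm (X ** Y) \<le> norm X * norm Y * K"
    using matrix_mult.pos_bounded[where 'n = 'n] by blast
  have int: "?F B V integrable_on {0..1}" for B V
    by (intro integrable_continuous_interval continuous_intros)
  have "linear ?D"
    by (intro linearI) (simp_all add: matrix_mult.add_left matrix_mult.add_right
        matrix_mult.scaleR_left matrix_mult.scaleR_right integral_add int)
  then have "bounded_linear ?D"
    by (simp add: linear_conv_bounded_linear)
  obtain M where M: "M \<ge> 0" "\<And>X Y :: complex^'n^'n. norm X \<le> norm A + 1 \<Longrightarrow>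
      norm Y \<le> norm A + 1 \<Longrightarrow> norm (matrix_exp Y - matrix_exp X) \<le> M * norm (Y - X)"
    using matrix_exp_lipschitz by blast
  have "compact ((\<lambda>s. matrix_exp ((1 - s) *\<^sub>R A)) ` {0..1})"
    by (intro compact_continuous_image continuous_intros) auto
  from compact_imp_bounded[OF this] obtain m where m: "m > 0" "\<And>s. s \<in> {0..1} \<Longrightarrow> norm (matrix_exp ((1 - s) *\<^sub>R A)) \<le> m"
    unfolding bounded_pos by blast
  have "\<forall>\<^sub>F B in at A. B \<in> ball A 1"
    by (rule eventually_at_in_open') auto
  then have bound: "\<forall>\<^sub>F B in at A. norm ((matrix_exp B - matrix_exp A - ?D (B - A)) /\<^sub>R norm (B - A))
      \<le> M * K * m * K * norm (B - A)"
    using eventually_neq_at_within[of A A]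
  proof eventually_elim
    case (elim B)
    then have B: "norm B \<le> norm A + 1"
      using norm_triangle_ineq2[of B A] by (simp add: dist_norm norm_minus_commute)
    have "((\<lambda>s. ?F B (B - A) s - ?F A (B - A) s) has_integral
        matrix_exp B - matrix_exp A - ?D (B - A)) (cbox 0 1)"
      unfolding box_real
      by (intro has_integral_diff matrix_exp_duhamel integrable_integral int)
    moreover have "norm (?F B (B - A) s - ?F A (B - A) s) \<le> M * K * m * K * (norm (B - A))\<^sup>2"
      if s: "s \<in> {0..1}" for s
    proof -
      have scale_le: "norm (s *\<^sub>R X) \<le> norm A + 1" if "norm X \<le> norm A + 1" for X :: "complex^'n^'n"
        using mult_mono[of s 1 "norm X" "norm A + 1"] that s by auto
      have "norm (matrix_exp (s *\<^sub>R B) - matrix_exp (s *\<^sub>R A)) \<le> M * norm (s *\<^sub>R B - s *\<^sub>R A)"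
        by (intro M scale_le B) simp
      also have "s *\<^sub>R B - s *\<^sub>R A = s *\<^sub>R (B - A)"
        by (simp add: scaleR_diff_right)
      also have "M * norm (s *\<^sub>R (B - A)) \<le> M * norm (B - A)"
        using s M(1) by (intro mult_left_mono) (auto simp: mult_left_le_one_le)
      finally have le: "norm (matrix_exp (s *\<^sub>R B) - matrix_exp (s *\<^sub>R A)) \<le> M * norm (B - A)" .
      have "?F B (B - A) s - ?F A (B - A) s
          = (matrix_exp (s *\<^sub>R B) - matrix_exp (s *\<^sub>R A)) ** (B - A) ** matrix_exp ((1 - s) *\<^sub>R A)"
        by (simp only: matrix_mult.diff_left)
      also have "norm \<dots> \<le> norm ((matrix_exp (s *\<^sub>R B) - matrix_exp (s *\<^sub>R A)) ** (B - A))
          * norm (matrix_exp ((1 - s) *\<^sub>R A)) * K"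
        by (rule K)
      also have "\<dots> \<le> (norm (matrix_exp (s *\<^sub>R B) - matrix_exp (s *\<^sub>R A)) * norm (B - A) * K) * m * K"
        using K s m by (intro mult_right_mono mult_mono m K) auto
      also have "\<dots> \<le> (M * norm (B - A) * norm (B - A) * K) * m * K"
        using K m le by (intro mult_right_mono) auto
      finally show ?thesis
        by (simp add: algebra_simps power2_eq_square)
    qed
    ultimately have "norm (matrix_exp B - matrix_exp A - ?D (B - A))
        \<le> M * K * m * K * (norm (B - A))\<^sup>2 * measure lborel (cbox 0 (1 :: real))"
      by (rule has_integral_bound[rotated]) (use M(1) K(1) m(1) in simp_all)
    then show ?case
      using elim(2) by (simp add: divide_simps power2_eq_square)
  qed
  have "((\<lambda>B. M * K * m * K * norm (B - A)) \<longlongrightarrow> M * K * m * K * norm (A - A)) (at A)"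
    by (intro tendsto_intros)
  then have "((\<lambda>B. (matrix_exp B - matrix_exp A - ?D (B - A)) /\<^sub>R norm (B - A)) \<longlongrightarrow> 0) (at A)"
    by (intro Lim_null_comparison[OF bound]) simp
  with \<open>bounded_linear ?D\<close> show ?thesis
    by (simp add: has_derivative_def)
qed

text \<open>The derivative is a parameter integral of products of exponentials. By the induction
  hypothesis these are of class \<open>C^k\<close> jointly in the matrix and \<open>s\<close>, so
  the integral is of class \<open>C^k\<close> too.\<close>

lemma Ck_on_matrix_exp: "Ck_on k UNIV (matrix_exp :: complex^'n^'n \<Rightarrow> _)"
proof (induction k)
  case 0
  then show ?case
    by (simp add: continuous_on_eq_continuous_at isCont_matrix_exp)
next
  case (Suc k)
  have comp: "Ck_on k UNIV (\<lambda>p. matrix_exp (g p *\<^sub>R fst p))"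
    if "Ck_on k UNIV g" for g :: "(complex^'n^'n) \<times> real \<Rightarrow> real"
    by (rule Ck_on_compose[OF open_UNIV open_UNIV subset_UNIV Suc])
      (rule Ck_on_bilinear[OF bounded_bilinear_scaleR open_UNIV that
          Ck_on_bounded_linear[OF open_UNIV bounded_linear_fst]])
  have snd: "Ck_on k UNIV (snd :: (complex^'n^'n) \<times> real \<Rightarrow> real)"
    by (intro Ck_on_bounded_linear bounded_linear_snd) simp
  have "Ck_on k UNIV (\<lambda>A :: complex^'n^'n. integral {0..1}
      (\<lambda>s. matrix_exp (snd (A, s) *\<^sub>R fst (A, s)) ** V ** matrix_exp ((1 - snd (A, s)) *\<^sub>R fst (A, s))))"
    for V
    by (rule Ck_on_integral[of UNIV UNIV k "\<lambda>p. matrix_exp (snd p *\<^sub>R fst p) ** V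
            ** matrix_exp ((1 - snd p) *\<^sub>R fst p)"])
      (intro open_UNIV subset_UNIV Ck_on_bilinear[OF matrix_mult.bounded_bilinear_axioms] comp snd
        Ck_on_const Ck_on_diff)+
  then show ?case
    by (intro Ck_on_SucI[OF open_UNIV has_derivative_matrix_exp]) simp
qed

section \<open>The logarithm on the image of the strip\<close>

lemma of_real_vector_scale: "(of_real r :: complex) *s v = r *\<^sub>R v"
  by (simp add: vec_eq_iff) (simp add: scaleR_conv_of_real)

lemma vector_polynomial_relation:
  fixes a :: "nat \<Rightarrow> complex^'n"
  obtains p :: "complex poly" where "p \<noteq> 0" "(\<Sum>k\<le>degree p. coeff p k *s a k) = 0"
proof -
  define N where "N = DIM(complex^'n)"
  have "\<exists>c :: nat \<Rightarrow> complex. (\<exists>k\<le>N. c k \<noteq> 0) \<and> (\<Sum>k\<le>N. c k *s a k) = 0"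
  \<comment> \<open>\<open>N\<close> is the real dimension, so \<open>N + 1\<close> distinct vectors
    are linearly dependent over the reals, and the coefficients are read as complex numbers. Since
    \<open>dependent\<close> speaks of sets, repeated vectors need the separate relation with
    coefficients \<open>1\<close> and \<open>- 1\<close>.\<close>
  proof (cases "inj_on a {..N}")
    case True
    then have "card (a ` {..N}) = Suc N"
      by (simp add: card_image)
    then have "dependent (a ` {..N})"
      using independent_bound[of "a ` {..N}"] by (auto simp: N_def)
    then obtain u where u: "\<exists>v\<in>a ` {..N}. u v \<noteq> 0" "(\<Sum>v\<in>a ` {..N}. u v *\<^sub>R v) = 0"
      by (auto simp: dependent_finite)
    have "(\<Sum>k\<le>N. of_real (u (a k)) *s a k) = (\<Sum>v\<in>a ` {..N}. u v *\<^sub>R v)"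
      by (simp add: sum.reindex[OF True] of_real_vector_scale)
    with u show ?thesis
      by (intro exI[of _ "\<lambda>k. of_real (u (a k))"]) auto
  next
    case False
    then obtain i j where ij: "i \<le> N" "j \<le> N" "i \<noteq> j" "a i = a j"
      by (auto simp: inj_on_def)
    let ?c = "\<lambda>k. if k = i then 1 else if k = j then - 1 else (0 :: complex)"
    have "(\<Sum>k\<le>N. ?c k *s a k) = (\<Sum>k\<in>{i, j}. ?c k *s a k)"
      using ij by (intro sum.mono_neutral_right) auto
    also have "\<dots> = 0"
      using ij by simp
    finally show ?thesis
      using ij by (intro exI[of _ ?c]) auto
  qed
  then obtain c :: "nat \<Rightarrow> complex" and m
    where c: "m \<le> N" "c m \<noteq> 0" "(\<Sum>k\<le>N. c k *s a k) = 0"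
    by blast
  define p where "p = (\<Sum>k\<le>N. monom (c k) k)"
  have coeff: "coeff p k = (if k \<le> N then c k else 0)" for k
    by (simp add: p_def coeff_sum sum.delta)
  have "degree p \<le> N"
    by (rule degree_le) (simp add: coeff)
  then have "(\<Sum>k\<le>degree p. coeff p k *s a k) = (\<Sum>k\<le>N. coeff p k *s a k)"
    by (intro sum.mono_neutral_left) (auto simp: coeff_eq_0)
  also have "\<dots> = 0"
    using c(3) by (simp add: coeff)
  finally show ?thesis
    using c(1,2) coeff[of m] by (intro that[of p]) auto
qed

text \<open>Since \<open>E\<close> and \<open>A\<close> commute, the vectors \<open>w\<close>,
  \<open>A *v w\<close>, and so on all stay in the eigenspace of \<open>E\<close> for
  \<open>z\<close>, and an eigenvector of \<open>A\<close> is found in their span. This carries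
  eigenvalues of an exponential back to eigenvalues of its exponent.\<close>

lemma common_eigenvector:
  fixes A E :: "complex^'n^'n"
  assumes comm: "E ** A = A ** E" and w: "w \<noteq> 0" "E *v w = z *s w"
  obtains u \<mu> where "u \<noteq> 0" "A *v u = \<mu> *s u" "E *v u = z *s u"
proof -
  define a where "a k = matrix_pow A k *v w" for k
  have a_Suc: "A *v a k = a (Suc k)" for k
    by (simp add: a_def matrix_vector_mul_assoc)
  have E_a: "E *v a k = z *s a k" for k
    by (simp add: a_def matrix_vector_mul_assoc matrix_pow_commute[OF comm])
      (simp add: w(2) vec.scale flip: matrix_vector_mul_assoc)
  define ev where "ev p = (\<Sum>k\<le>degree p. coeff p k *s a k)" for p
  have ev_eq: "ev p = (\<Sum>k\<le>N. coeff p k *s a k)" if "degree p \<le> N" for p N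
    unfolding ev_def using that by (intro sum.mono_neutral_left) (auto simp: coeff_eq_0)
  \<comment> \<open>If \<open>p\<close> has least degree among the nonzero polynomials with \<open>p(A) w = 0\<close> and \<open>\<mu>\<close> is a root of \<open>p\<close>,
    then \<open>u = (p / (x - \<mu>))(A) w\<close> is an eigenvector.\<close>
  obtain p0 where "p0 \<noteq> 0 \<and> ev p0 = 0"
    using vector_polynomial_relation[of a] unfolding ev_def by metis
  then obtain p where p: "p \<noteq> 0" "ev p = 0"
    and least: "\<And>q. q \<noteq> 0 \<and> ev q = 0 \<Longrightarrow> degree p \<le> degree q"
    using ex_has_least_nat[of "\<lambda>p. p \<noteq> 0 \<and> ev p = 0" p0 degree] by blast
  have "degree p \<noteq> 0"
  proof
    assume "degree p = 0"
    then obtain c where "p = [:c:]"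
      by (rule degree_eq_zeroE)
    with p show False
      using w(1) by (simp add: ev_def a_def)
  qed
  then have "\<not> constant (poly p)"
    by (simp add: constant_degree)
  from fundamental_theorem_of_algebra[OF this] obtain \<mu> where "poly p \<mu> = 0"
    by auto
  then obtain q where q: "p = [:- \<mu>, 1:] * q"
    using poly_eq_0_iff_dvd[of p \<mu>] unfolding dvd_def by blast
  with p(1) have "q \<noteq> 0"
    by auto
  then have deg: "degree p = Suc (degree q)"
    unfolding q by (subst degree_mult_eq) simp_all
  with least[of q] \<open>q \<noteq> 0\<close> have "ev q \<noteq> 0"
    by auto
  let ?N = "Suc (degree q)"
  \<comment> \<open>Multiplying \<open>q\<close> by the variable shifts its coefficients, which
    amounts to applying \<open>A\<close> to \<open>ev q\<close>. Hence \<open>ev p = 0\<close> turns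
    into the eigenvector equation for \<open>ev q\<close>.\<close>
  have coeff_p: "coeff p k = (case k of 0 \<Rightarrow> 0 | Suc k \<Rightarrow> coeff q k) - \<mu> * coeff q k" for k
    by (simp add: q coeff_pCons)
  have "0 = ev p"
    by (simp add: p)
  also have "\<dots> = (\<Sum>k\<le>?N. (case k of 0 \<Rightarrow> 0 | Suc k \<Rightarrow> coeff q k) *s a k) - \<mu> *s (\<Sum>k\<le>?N. coeff q k *s a k)"
    using deg by (simp only: ev_eq[of p ?N] coeff_p)
      (simp only: vec.scale_left_diff_distrib sum_subtractf vec.scale_sum_right vec.scale_scale)
  also have "(\<Sum>k\<le>?N. (case k of 0 \<Rightarrow> 0 | Suc k \<Rightarrow> coeff q k) *s a k) = (\<Sum>k\<le>degree q. coeff q k *s a (Suc k))"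
    by (subst sum.atMost_Suc_shift) simp
  also have "\<dots> = A *v ev q"
    by (simp add: ev_def vec.sum vec.scale a_Suc)
  also have "(\<Sum>k\<le>?N. coeff q k *s a k) = ev q"
    by (rule ev_eq[symmetric]) simp
  finally have "A *v ev q = \<mu> *s ev q"
    by simp
  moreover have "E *v ev q = z *s ev q"
    by (simp add: ev_def vec.sum vec.scale E_a vec.scale_sum_right mult.commute)
  ultimately show ?thesis
    using \<open>ev q \<noteq> 0\<close> that by blast
qed

text \<open>The spectral condition is imposed on all matrices, so that openness and the logarithm
  live in the ambient space; the set of the theorem is the intersection with the Lie
  algebra.\<close>

definition strip :: "(complex^'n^'n) set" where
  "strip = {A. \<forall>\<mu>. eigenvalue A \<mu> \<longrightarrow> \<bar>Im \<mu>\<bar> < pi}"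

text \<open>The complement is closed by compactness: unit eigenvectors and their eigenvalues along a
  convergent sequence subconverge to an eigenpair of the limit, and the condition on the imaginary
  part is closed.\<close>

lemma open_strip: "open (strip :: (complex^'n^'n) set)"
proof -
  have "closed (- strip :: (complex^'n^'n) set)"
    unfolding closed_sequential_limits
  proof (intro allI impI, elim conjE)
    fix X :: "nat \<Rightarrow> complex^'n^'n" and A
    assume X: "\<forall>n. X n \<in> - strip" and lim: "X \<longlonglongrightarrow> A"
    have "\<exists>v \<mu>. v \<noteq> 0 \<and> X n *v v = \<mu> *s v \<and> \<bar>Im \<mu>\<bar> \<ge> pi" for n
      using X unfolding strip_def eigenvalue_def by (simp add: not_less) blast
    then obtain v \<mu> where v\<mu>: "\<And>n. v n \<noteq> 0" "\<And>n. X n *v v n = \<mu> n *s v n" "\<And>n. \<bar>Im (\<mu> n)\<bar> \<ge> pi"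
      by metis
    define u where "u n = v n /\<^sub>R norm (v n)" for n
    have u: "norm (u n) = 1" "X n *v u n = \<mu> n *s u n" for n
      using v\<mu>(1,2)[of n] by (simp_all add: u_def matrix_vector_mult.scaleR_right vec_eq_iff)
    obtain K where K: "K > 0"
      "\<And>(X :: complex^'n^'n) (v :: complex^'n). norm (X *v v) \<le> norm X * norm v * K"
      using matrix_vector_mult.pos_bounded[where 'n = 'n] by blast
    obtain M where M: "\<And>n. norm (X n) \<le> M"
      using convergent_imp_bounded[OF lim] by (auto simp: bounded_iff)
    have \<mu>_le: "norm (\<mu> n) \<le> M * K" for n
    proof -
      have "norm (\<mu> n *s u n) = norm (\<mu> n) * norm (u n)"
        by (simp add: norm_vec_def norm_mult L2_set_right_distrib)
      then have "norm (\<mu> n) = norm (X n *v u n)"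
        by (simp add: u)
      also have "\<dots> \<le> norm (X n) * K"
        using K(2)[of "X n" "u n"] by (simp add: u)
      also have "\<dots> \<le> M * K"
        using M K(1) by (intro mult_right_mono) auto
      finally show ?thesis .
    qed
    have "seq_compact (sphere 0 1 \<times> cball 0 (M * K) :: ((complex^'n) \<times> complex) set)"
      by (intro compact_imp_seq_compact compact_Times compact_sphere compact_cball)
    moreover have "\<forall>n. (u n, \<mu> n) \<in> sphere 0 1 \<times> cball 0 (M * K)"
      by (simp add: u \<mu>_le)
    ultimately obtain l r where lr: "l \<in> sphere 0 1 \<times> cball 0 (M * K)" "strict_mono r"
      "((\<lambda>n. (u n, \<mu> n)) \<circ> r) \<longlonglongrightarrow> l"
      by (rule seq_compactE)
    obtain u' \<mu>' where l: "l = (u', \<mu>')"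
      by (cases l)
    have lim_u: "(\<lambda>n. u (r n)) \<longlonglongrightarrow> u'" and lim_\<mu>: "(\<lambda>n. \<mu> (r n)) \<longlonglongrightarrow> \<mu>'"
      using tendsto_fst[OF lr(3)] tendsto_snd[OF lr(3)] by (simp_all add: l o_def)
    have "(\<lambda>n. X (r n) *v u (r n)) \<longlonglongrightarrow> A *v u'"
      using LIMSEQ_subseq_LIMSEQ[OF lim lr(2)] lim_u
      by (intro matrix_vector_mult.tendsto) (simp_all add: o_def)
    moreover have "(\<lambda>n. \<mu> (r n) *s u (r n)) \<longlonglongrightarrow> \<mu>' *s u'"
      using lim_u lim_\<mu> unfolding vector_scalar_mult_def by (intro tendsto_intros)
    ultimately have "A *v u' = \<mu>' *s u'"
      by (simp add: u LIMSEQ_unique)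
    moreover have "u' \<noteq> 0"
      using lr(1) by (auto simp: l)
    moreover have "\<bar>Im \<mu>'\<bar> \<ge> pi"
      using v\<mu>(3) by (intro LIMSEQ_le_const[OF tendsto_rabs[OF tendsto_Im[OF lim_\<mu>]]]) auto
    ultimately show "A \<in> - strip"
      by (auto simp: strip_def eigenvalue_def not_less)
  qed
  then show ?thesis
    by (simp add: closed_def)
qed

lemma zero_mem_strip: "0 \<in> strip"
  by (auto simp: strip_def eigenvalue_def vec_eq_iff)

text \<open>A kernel vector would make a real \<open>x \<le> 0\<close> an eigenvalue of
  \<open>matrix_exp (t *\<^sub>R A)\<close>. A common eigenvector then gives
  \<open>x = exp (t *\<^sub>R \<mu>)\<close> with \<mu> an eigenvalue of \<open>A\<close>; as the
  exponent has imaginary part below \<open>pi\<close> in absolute value, a real value of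
  \<open>exp\<close> must be positive.\<close>

lemma invertible_strip_segment:
  fixes A :: "complex^'n^'n"
  assumes A: "A \<in> strip" and ts: "t \<in> {0..1}" "s \<in> {0..1}"
  shows "invertible (mat 1 + s *\<^sub>R (matrix_exp (t *\<^sub>R A) - mat 1))"
proof (rule ccontr)
  let ?E = "matrix_exp (t *\<^sub>R A)"
  assume "\<not> ?thesis"
  then obtain w where w: "w \<noteq> 0" "(mat 1 + s *\<^sub>R (?E - mat 1)) *v w = 0"
    unfolding invertible_left_inverse matrix_left_invertible_ker by blast
  have eq: "w + s *\<^sub>R (?E *v w - w) = 0"
    using w(2) by (simp add: matrix_vector_mult.add_left matrix_vector_mult.scaleR_left
        matrix_vector_mult.diff_left)
  with w(1) have s: "s > 0"
    using ts by (cases "s = 0") auto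
  \<comment> \<open>This solves the kernel equation for \<open>?E *v w\<close>; it is not positive
    because \<open>0 < s \<le> 1\<close>.\<close>
  define x where "x = (s - 1) / s"
  have "s *\<^sub>R (?E *v w) = (s - 1) *\<^sub>R w"
    using eq by (simp add: algebra_simps)
  from arg_cong[OF this, of "(*\<^sub>R) (inverse s)"] have "?E *v w = x *\<^sub>R w"
    using s by (simp add: x_def divide_inverse mult.commute)
  then have "?E *v w = of_real x *s w"
    by (simp add: of_real_vector_scale)
  moreover have "?E ** A = A ** ?E"
    by (rule matrix_exp_commute[symmetric])
      (simp add: matrix_mult.scaleR_left matrix_mult.scaleR_right)
  ultimately obtain u \<mu> where u: "u \<noteq> 0" "A *v u = \<mu> *s u" "?E *v u = of_real x *s u"
    using common_eigenvector w(1) by metis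
  have "(t *\<^sub>R A) *v u = (t *\<^sub>R \<mu>) *s u"
    by (simp add: matrix_vector_mult.scaleR_left u(2) vec_eq_iff)
  from matrix_exp_eigenvector[OF this] have "exp (t *\<^sub>R \<mu>) *s u = of_real x *s u"
    using u(3) by metis
  with u(1) have exp_eq: "exp (t *\<^sub>R \<mu>) = of_real x"
    by simp
  have "\<bar>Im \<mu>\<bar> < pi"
    using A u by (auto simp: strip_def eigenvalue_def)
  then have "\<bar>t * Im \<mu>\<bar> < pi"
    using ts mult_right_mono[of t 1 "\<bar>Im \<mu>\<bar>"] by (simp add: abs_mult)
  moreover have "sin (t * Im \<mu>) = 0"
    using arg_cong[OF exp_eq, of Im] by (simp add: Im_exp)
  ultimately have "t * Im \<mu> = 0"
    using sin_eq_0_pi[of "t * Im \<mu>"] by (simp add: abs_less_iff)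
  then have "x = exp (t * Re \<mu>)"
    using arg_cong[OF exp_eq, of Re] by (auto simp: Re_exp)
  then have "x > 0"
    by simp
  moreover have "x \<le> 0"
    using s ts by (simp add: x_def divide_simps)
  ultimately show False
    by simp
qed

section \<open>The logarithm integral as a smooth inverse of the exponential\<close>

text \<open>The integrand is the derivative in \<open>s\<close> of the formal logarithm of \<open>1 + s (B - 1)\<close>.\<close>

definition matrix_log :: "complex^'n^'n \<Rightarrow> complex^'n^'n" where
  "matrix_log B = integral {0..1} (\<lambda>s. (B - mat 1) ** matrix_inv (mat 1 + s *\<^sub>R (B - mat 1)))"

lemma has_vector_derivative_matrix_inv:
  fixes f :: "real \<Rightarrow> complex^'n^'n"
  assumes "(f has_vector_derivative f') (at x within S)" "invertible (f x)"
  shows "((\<lambda>x. matrix_inv (f x)) has_vector_derivative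
    - (matrix_inv (f x) ** f' ** matrix_inv (f x))) (at x within S)"
  using has_derivative_compose[OF assms(1)[unfolded has_vector_derivative_def]
      has_derivative_matrix_inv[OF assms(2)]]
  by (simp add: has_vector_derivative_def matrix_mult.scaleR_left matrix_mult.scaleR_right)

lemma continuous_on_matrix_inv:
  fixes f :: "'a::topological_space \<Rightarrow> complex^'n^'n"
  assumes "continuous_on S f" "\<And>x. x \<in> S \<Longrightarrow> invertible (f x)"
  shows "continuous_on S (\<lambda>x. matrix_inv (f x))"
proof (rule continuous_on_compose2[of "{A. invertible A}" matrix_inv])
  show "continuous_on {A :: complex^'n^'n. invertible A} matrix_inv"
    using isCont_matrix_inv by (intro continuous_at_imp_continuous_on) auto
qed (use assms in auto)

text \<open>The \<open>t\<close>-derivative of the integrand of \<open>matrix_log (E t)\<close> is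
  \<open>C t ** R t s ** R t s\<close>, which is also the \<open>s\<close>-derivative of
  \<open>C t ** (s *\<^sub>R R t s)\<close>. Its integral over \<open>s\<close> is therefore
  \<open>A ** E t ** R t 1 = A\<close>, and integrating over \<open>t\<close> from
  \<open>matrix_log (mat 1) = 0\<close> gives \<open>A\<close>.\<close>

lemma matrix_log_exp:
  fixes A :: "complex^'n^'n"
  assumes A: "A \<in> strip"
  shows "matrix_log (matrix_exp A) = A"
proof -
  define E where "E t = matrix_exp (t *\<^sub>R A)" for t :: real
  define Z where "Z t s = mat 1 + s *\<^sub>R (E t - mat 1)" for t s :: real
  define R where "R t s = matrix_inv (Z t s)" for t s
  have inv: "invertible (Z t s)" if "t \<in> {0..1}" "s \<in> {0..1}" for t s
    unfolding Z_def E_def by (rule invertible_strip_segment[OF A that])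
  have AE: "A ** E t = E t ** A" for t
    unfolding E_def by (rule matrix_exp_commute)
      (simp add: matrix_mult.scaleR_left matrix_mult.scaleR_right)
  have comm_R: "C ** R t s = R t s ** C" if "t \<in> {0..1}" "s \<in> {0..1}" "C ** E t = E t ** C"
    for C t s
    unfolding R_def
    by (rule matrix_inv_commute[OF inv]) (use that in \<open>simp_all add: Z_def matrix_mult.add_left
      matrix_mult.add_right matrix_mult.diff_left matrix_mult.diff_right matrix_mult.scaleR_left
      matrix_mult.scaleR_right\<close>)
  have XR: "(E t - mat 1) ** R t s = R t s ** (E t - mat 1)" if "t \<in> {0..1}" "s \<in> {0..1}" for t s
    by (rule comm_R[OF that]) (simp add: matrix_mult.diff_left matrix_mult.diff_right)
  have RZ: "R t s + s *\<^sub>R (R t s ** (E t - mat 1)) = mat 1"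
    if "t \<in> {0..1}" "s \<in> {0..1}" for t s
    using matrix_inv_left[OF inv[OF that]]
    by (simp add: R_def Z_def matrix_mult.add_right matrix_mult.scaleR_right)
  \<comment> \<open>Multiplying \<open>RZ\<close> by the resolvent on the right. The resulting
    expression is exactly the \<open>s\<close>-derivative of
    \<open>s *\<^sub>R R t s\<close>.\<close>
  then have RR: "R t s ** R t s = R t s - s *\<^sub>R (R t s ** (E t - mat 1) ** R t s)"
    if "t \<in> {0..1}" "s \<in> {0..1}" for t s
  proof -
    have "R t s = (R t s + s *\<^sub>R (R t s ** (E t - mat 1))) ** R t s"
      using RZ[OF that] by simp
    then show ?thesis
      by (simp add: matrix_mult.add_left matrix_mult.scaleR_left algebra_simps)
  qed
  define C where "C t = A ** E t" for t
  have contE: "continuous_on S (\<lambda>x. E (f x))" if "continuous_on S f"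
    for S :: "(real \<times> real) set" and f
    unfolding E_def by (intro continuous_intros that)
  have contR: "continuous_on ({0..1} \<times> {0..1}) (\<lambda>p. R (fst p) (snd p))"
    unfolding R_def
  proof (rule continuous_on_matrix_inv)
    show "continuous_on ({0..1} \<times> {0..1}) (\<lambda>p. Z (fst p) (snd p))"
      unfolding Z_def by (intro continuous_intros contE)
  qed (auto intro: inv)
  have contR': "continuous_on {0..1} (R t)" if "t \<in> {0..1}" for t
  proof -
    have "continuous_on {0..1} (\<lambda>s. R (fst (t, s)) (snd (t, s)))"
      by (rule continuous_on_compose2[OF contR]) (use that in \<open>auto intro!: continuous_intros\<close>)
    then show ?thesis
      by simp
  qed
  have int: "((\<lambda>s. C t ** R t s ** R t s) has_integral A) {0..1}" if t: "t \<in> {0..1}" for t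
  proof -
    have "((\<lambda>s. C t ** (s *\<^sub>R R t s)) has_vector_derivative C t ** R t s ** R t s)
        (at s within {0..1})" if s: "s \<in> {0..1}" for s
    proof -
      have "((\<lambda>s. Z t s) has_vector_derivative E t - mat 1) (at s within {0..1})"
        unfolding Z_def by (auto intro!: derivative_eq_intros)
      from has_vector_derivative_matrix_inv[OF this inv[OF t s]]
      have "((\<lambda>s. R t s) has_vector_derivative - (R t s ** (E t - mat 1) ** R t s)) (at s within {0..1})"
        by (simp add: R_def)
      then have "((\<lambda>s. s *\<^sub>R R t s) has_vector_derivative
          R t s ** R t s) (at s within {0..1})"
        unfolding RR[OF t s]
        by (auto intro!: derivative_eq_intros)
      from bounded_linear.has_vector_derivative[OF matrix_mult.bounded_linear_right this]
      show ?thesis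
        by (simp add: matrix_mul_assoc)
    qed
    from fundamental_theorem_of_calculus[OF _ this]
    have "((\<lambda>s. C t ** R t s ** R t s) has_integral C t ** (1 *\<^sub>R R t 1) - C t ** (0 *\<^sub>R R t 0)) {0..1}"
      by simp
    moreover have "E t ** R t 1 = mat 1"
      using matrix_inv_right[OF inv[OF t, of 1]] by (simp add: R_def Z_def)
    then have "C t ** R t 1 = A"
      by (simp add: C_def flip: matrix_mul_assoc)
    ultimately show ?thesis
      by (simp add: matrix_mult.zero_right)
  qed
  have D: "((\<lambda>t. integral (cbox 0 1) (\<lambda>s. (E t - mat 1) ** R t s)) has_vector_derivative
      integral (cbox 0 1) (\<lambda>s. C t ** R t s ** R t s)) (at t within {0..1})"
    if t: "t \<in> {0..1}" for t
  proof (rule leibniz_rule_vector_derivative)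
    fix t s :: real
    assume t: "t \<in> {0..1}" and s: "s \<in> cbox 0 1"
    then have s: "s \<in> {0..1}"
      by simp
    have dE: "(E has_vector_derivative C t) (at t within {0..1})"
      unfolding E_def C_def by (rule has_vector_derivative_at_within[OF has_vector_derivative_matrix_exp])
    then have "((\<lambda>t. Z t s) has_vector_derivative s *\<^sub>R C t) (at t within {0..1})"
      unfolding Z_def by (auto intro!: derivative_eq_intros)
    from has_vector_derivative_matrix_inv[OF this inv[OF t s]]
    have "((\<lambda>t. R t s) has_vector_derivative - (s *\<^sub>R (R t s ** C t ** R t s))) (at t within {0..1})"
      by (simp add: R_def matrix_mult.scaleR_left matrix_mult.scaleR_right)
    moreover have "((\<lambda>t. E t - mat 1) has_vector_derivative C t) (at t within {0..1})"
      using dE by (auto intro!: derivative_eq_intros)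
    ultimately have "((\<lambda>t. (E t - mat 1) ** R t s) has_vector_derivative
        (E t - mat 1) ** - (s *\<^sub>R (R t s ** C t ** R t s)) + C t ** R t s) (at t within {0..1})"
      by (intro bounded_bilinear.has_vector_derivative[OF matrix_mult.bounded_bilinear_axioms])
    \<comment> \<open>All factors are built from \<open>A\<close> and commute, so \<open>C t\<close>
      can be pulled to the front; what remains is the right side of \<open>RR\<close>.\<close>
    moreover have "(E t - mat 1) ** - (s *\<^sub>R (R t s ** C t ** R t s)) + C t ** R t s
        = C t ** R t s ** R t s"
    proof -
      have CE: "C t ** E t = E t ** C t"
        by (metis AE C_def matrix_mul_assoc)
      have CX: "C t ** (E t - mat 1) = (E t - mat 1) ** C t"
        by (simp add: CE matrix_mult.diff_left matrix_mult.diff_right)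
      have "(E t - mat 1) ** (R t s ** C t ** R t s) = C t ** (R t s ** (E t - mat 1) ** R t s)"
        by (metis CX comm_R[OF t s CE] XR[OF t s] matrix_mul_assoc)
      then show ?thesis
        by (simp add: matrix_mult.minus_right matrix_mult.scaleR_right matrix_mult.diff_right
            RR[OF t s] flip: matrix_mul_assoc)
    qed
    ultimately show "((\<lambda>t. (E t - mat 1) ** R t s) has_vector_derivative C t ** R t s ** R t s)
        (at t within {0..1})"
      by simp
  next
    show "(\<lambda>s. (E t - mat 1) ** R t s) integrable_on cbox 0 1" if "t \<in> {0..1}" for t
      using contR'[OF that] by (intro integrable_continuous continuous_intros) simp
    have "continuous_on ({0..1} \<times> {0..1}) (\<lambda>p. C (fst p) ** R (fst p) (snd p) ** R (fst p) (snd p))"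
      unfolding C_def by (intro continuous_intros contR contE)
    then show "continuous_on ({0..1} \<times> cbox 0 1) (\<lambda>(t, s). C t ** R t s ** R t s)"
      by (simp add: case_prod_unfold)
  qed (use t in auto)
  have "((\<lambda>t. matrix_log (E t)) has_vector_derivative A) (at t within {0..1})"
    if "t \<in> {0..1}" for t
    using D[OF that] integral_unique[OF int[OF that]] by (simp add: matrix_log_def R_def Z_def)
  from fundamental_theorem_of_calculus[OF _ this]
  have "((\<lambda>t. A) has_integral matrix_log (E 1) - matrix_log (E 0)) {0..1 :: real}"
    by simp
  moreover have "((\<lambda>t. A) has_integral A) {0..1 :: real}"
    using has_integral_const_real[of A 0 1] by simp
  ultimately have "matrix_log (E 1) - matrix_log (E 0) = A"
    by (rule has_integral_unique)
  moreover have "matrix_log (E 0) = 0"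
    by (simp add: matrix_log_def E_def matrix_mult.zero_left)
  ultimately show ?thesis
    by (simp add: E_def)
qed

lemma inj_on_matrix_exp: "inj_on matrix_exp strip"
  using matrix_log_exp by (rule inj_on_inverseI)

text \<open>The left inverse \<open>matrix_log\<close> makes the exponential injective on the strip,
  and invariance of domain turns a continuous injection into an open map.\<close>

lemma open_matrix_exp_image:
  assumes "open S" "S \<subseteq> strip"
  shows "open (matrix_exp ` S :: (complex^'n^'n) set)"
  using assms inj_on_subset[OF inj_on_matrix_exp]
  by (intro invariance_of_domain continuous_on_matrix_exp continuous_on_id)

lemma Ck_on_matrix_log: "Ck_on k (matrix_exp ` strip) (matrix_log :: complex^'n^'n \<Rightarrow> _)"
proof -
  define Z where "Z p = mat 1 + snd p *\<^sub>R (fst p - mat 1)" for p :: "(complex^'n^'n) \<times> real"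
  let ?S = "{p. invertible (Z p)}"
  have "continuous_on UNIV Z"
    unfolding Z_def by (intro continuous_intros)
  then have "open (Z -` {A. invertible A})"
    by (rule open_vimage[OF open_invertible])
  then have S: "open ?S"
    by (simp add: vimage_def)
  have fst: "Ck_on k ?S fst" and snd: "Ck_on k ?S snd"
    by (intro Ck_on_bounded_linear S bounded_linear_fst bounded_linear_snd)+
  have X: "Ck_on k ?S (\<lambda>p. fst p - mat 1)"
    by (intro Ck_on_diff Ck_on_const S fst)
  have "Ck_on k ?S Z"
    unfolding Z_def[abs_def]
    by (intro Ck_on_add Ck_on_const Ck_on_bilinear[OF bounded_bilinear_scaleR] S snd
        X[unfolded Z_def]) (use S X snd in \<open>simp_all add: Z_def\<close>)
  then have "Ck_on k ?S (\<lambda>p. (fst p - mat 1) ** matrix_inv (Z p))"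
    by (intro Ck_on_bilinear[OF matrix_mult.bounded_bilinear_axioms S] X Ck_on_matrix_inv[OF S]) simp
  then have "Ck_on k (matrix_exp ` strip) (\<lambda>B. integral {0..1}
      (\<lambda>s. (fst (B, s) - mat 1) ** matrix_inv (Z (B, s))))"
  proof (rule Ck_on_integral[rotated 2])
    show "open (matrix_exp ` strip)"
      by (rule open_matrix_exp_image) (simp_all add: open_strip)
    show "matrix_exp ` strip \<times> {0..1} \<subseteq> ?S"
      by (auto simp: Z_def intro!: invertible_strip_segment[of _ 1, simplified])
  qed
  then show ?thesis
    by (simp add: matrix_log_def[abs_def] Z_def)
qed

section \<open>Closed subgroups\<close>

lemma has_derivative_matrix_exp_zero: "(matrix_exp has_derivative (\<lambda>V. V)) (at (0 :: complex^'n^'n))"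
  using has_derivative_matrix_exp[of "0 :: complex^'n^'n"] by simp

lemma matrix_exp_log:
  assumes "B \<in> matrix_exp ` strip"
  shows "matrix_exp (matrix_log B) = B" "matrix_log B \<in> strip"
  using assms by (auto simp: matrix_log_exp)

lemma one_mem_matrix_exp_strip: "mat 1 \<in> matrix_exp ` strip"
  using zero_mem_strip by (metis image_eqI matrix_exp_0)

lemma open_matrix_exp_strip: "open (matrix_exp ` strip :: (complex^'n^'n) set)"
  by (rule open_matrix_exp_image) (simp_all add: open_strip)

lemma matrix_log_one: "matrix_log (mat 1) = 0"
  using matrix_log_exp[OF zero_mem_strip] by simp

text \<open>Differentiability is known from \<open>Ck_on_matrix_log\<close>; the chain rule for
  \<open>matrix_log (matrix_exp A) = A\<close> at \<open>0\<close>, where the exponential has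
  identity derivative, determines the value.\<close>

lemma has_derivative_matrix_log_one:
  "(matrix_log has_derivative (\<lambda>V. V)) (at (mat 1 :: complex^'n^'n))"
proof -
  let ?D = "frechet_derivative matrix_log (at (mat 1 :: complex^'n^'n))"
  have D: "(matrix_log has_derivative ?D) (at (mat 1 :: complex^'n^'n))"
    using Ck_on_has_derivative[OF Ck_on_matrix_log one_mem_matrix_exp_strip] .
  have "((\<lambda>A. matrix_log (matrix_exp A)) has_derivative ?D) (at (0 :: complex^'n^'n))"
    using has_derivative_compose[OF has_derivative_matrix_exp_zero, of matrix_log ?D] D by simp
  moreover have "((\<lambda>A. matrix_log (matrix_exp A)) has_derivative (\<lambda>V. V)) (at (0 :: complex^'n^'n))"
    by (rule has_derivative_transform_within_open[OF has_derivative_ident open_strip zero_mem_strip])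
      (simp add: matrix_log_exp)
  ultimately have "?D = (\<lambda>V. V)"
    by (rule has_derivative_unique)
  with D show ?thesis
    by simp
qed

section \<open>One-parameter subgroups and the Lie algebra of a closed subgroup\<close>

definition generators :: "(complex^'n^'n) set \<Rightarrow> (complex^'n^'n) set" where
  "generators G = {v. \<forall>t. matrix_exp (t *\<^sub>R v) \<in> G}"

context
  fixes G :: "(complex^'n^'n) set"
  assumes G: "closed_subgroup_GL G"
begin

lemma closed_subgroup_one: "mat 1 \<in> G"
  using G subgroup.one_closed[of G GL] by (simp add: closed_subgroup_GL_def GL_def)

lemma closed_subgroup_mult: "A \<in> G \<Longrightarrow> B \<in> G \<Longrightarrow> A ** B \<in> G"
  using G subgroup.m_closed[of G GL A B] by (simp add: closed_subgroup_GL_def GL_def)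

lemma matrix_exp_minus_mem:
  assumes "matrix_exp A \<in> G"
  shows "matrix_exp (- A) \<in> G"
proof -
  have "inv\<^bsub>GL\<^esub> (matrix_exp A) = matrix_exp (- A)"
    by (rule group.inv_equality[OF group_GL]) (simp_all add: GL_def matrix_exp_minus invertible_matrix_exp)
  then show ?thesis
    using G subgroup.m_inv_closed[OF _ assms] by (metis closed_subgroup_GL_def)
qed

lemma matrix_exp_of_nat_mem:
  assumes "matrix_exp A \<in> G"
  shows "matrix_exp (real m *\<^sub>R A) \<in> G"
proof (induction m)
  case (Suc m)
  then show ?case
    using closed_subgroup_mult[OF assms Suc] matrix_exp_add_scaleR[of 1 "real m" A] by (simp add: add.commute)
qed (simp add: closed_subgroup_one)

text \<open>\<open>G\<close> is closed only relative to the invertible matrices, so invertibility of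
  the limit has to be supplied; for limits that are exponentials it is automatic.\<close>

lemma closed_subgroup_limit:
  assumes "F \<noteq> bot" "\<forall>\<^sub>F i in F. f i \<in> G" "(f \<longlongrightarrow> B) F" "invertible B"
  shows "B \<in> G"
proof -
  obtain T where T: "closed T" "G = {A. invertible A} \<inter> T"
    using G by (auto simp: closed_subgroup_GL_def closedin_closed GL_def)
  have "B \<in> T"
    by (rule Lim_in_closed_set[OF T(1) _ assms(1,3)]) (use assms(2) T(2) in \<open>auto elim: eventually_mono\<close>)
  with assms(4) T show ?thesis
    by simp
qed

lemma matrix_exp_mem: "v \<in> generators G \<Longrightarrow> matrix_exp v \<in> G"
  unfolding generators_def by (metis (mono_tags, lifting) mem_Collect_eq scaleR_one)

text \<open>Integer multiples of \<open>X i\<close> have exponentials in \<open>G\<close>, and as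
  \<open>r i\<close> tends to 0 such multiples approximate every \<open>t *\<^sub>R v\<close> with
  \<open>t \<ge> 0\<close>. Closedness then applies, and inverses give negative \<open>t\<close>. A
  general filter serves both sequences and curves.\<close>

lemma generatorsI_limit:
  fixes X :: "'i \<Rightarrow> complex^'n^'n"
  assumes F: "F \<noteq> bot" and X: "\<forall>\<^sub>F i in F. matrix_exp (X i) \<in> G"
    and r: "\<forall>\<^sub>F i in F. r i > 0" "(r \<longlongrightarrow> 0) F"
    and lim: "((\<lambda>i. X i /\<^sub>R r i) \<longlongrightarrow> v) F"
  shows "v \<in> generators G"
proof -
  have pos: "matrix_exp (t *\<^sub>R v) \<in> G" if t: "t \<ge> 0" for t
  proof (rule closed_subgroup_limit[OF F _ _ invertible_matrix_exp])
    \<comment> \<open>Rounding \<open>t / r i\<close> down leaves \<open>real (m i) * r i\<close>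
      within \<open>r i\<close> of \<open>t\<close>, so the multiples of \<open>X i\<close> converge
      to \<open>t *\<^sub>R v\<close>.\<close>
    define m where "m i = nat \<lfloor>t / r i\<rfloor>" for i
    show "\<forall>\<^sub>F i in F. matrix_exp (real (m i) *\<^sub>R X i) \<in> G"
      using X by eventually_elim (rule matrix_exp_of_nat_mem)
    have "\<forall>\<^sub>F i in F. norm (real (m i) * r i - t) \<le> r i"
      using r(1)
    proof eventually_elim
      case (elim i)
      have "real (m i) = of_int \<lfloor>t / r i\<rfloor>"
        using elim t by (simp add: m_def)
      then have "real (m i) \<le> t / r i" "t / r i \<le> real (m i) + 1"
        by linarith+
      then have "real (m i) * r i \<le> t" "t \<le> (real (m i) + 1) * r i"
        using elim by (simp_all add: pos_le_divide_eq pos_divide_le_eq)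
      then show ?case
        by (simp add: algebra_simps abs_le_iff)
    qed
    then have "((\<lambda>i. real (m i) * r i - t) \<longlongrightarrow> 0) F"
      by (rule Lim_null_comparison[OF _ r(2)])
    then have "((\<lambda>i. real (m i) * r i) \<longlongrightarrow> t) F"
      by (rule LIM_zero_cancel)
    from tendsto_scaleR[OF this lim]
    have "((\<lambda>i. (real (m i) * r i) *\<^sub>R (X i /\<^sub>R r i)) \<longlongrightarrow> t *\<^sub>R v) F" .
    then have "((\<lambda>i. real (m i) *\<^sub>R X i) \<longlongrightarrow> t *\<^sub>R v) F"
      by (rule Lim_transform_eventually) (use r(1) in eventually_elim, simp)
    then show "((\<lambda>i. matrix_exp (real (m i) *\<^sub>R X i)) \<longlongrightarrow> matrix_exp (t *\<^sub>R v)) F"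
      by (rule isCont_tendsto_compose[OF isCont_matrix_exp])
  qed
  have "matrix_exp (t *\<^sub>R v) \<in> G" if "t < 0" for t
    using matrix_exp_minus_mem[OF pos[of "- t"]] that by simp
  with pos show ?thesis
    unfolding generators_def using linorder_not_le by blast
qed

text \<open>Apply \<open>generatorsI_limit\<close> to the logarithms of the curve with
  \<open>r\<close> the parameter itself: \<open>matrix_log\<close> has identity derivative at
  \<open>mat 1\<close>, so the quotients tend to the velocity \<open>v\<close>.\<close>

lemma generatorsI_curve:
  assumes "\<gamma> (0 :: real) = mat 1" "(\<gamma> has_vector_derivative v) (at 0)" "\<forall>\<^sub>F t in at_right 0. \<gamma> t \<in> G"
  shows "v \<in> generators G"
proof (rule generatorsI_limit)
  show "at_right (0 :: real) \<noteq> bot"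
    by simp
  have cont: "isCont \<gamma> 0"
    using assms(2) has_vector_derivative_continuous by blast
  have "\<forall>\<^sub>F t in at_right 0. \<gamma> t \<in> matrix_exp ` strip"
  proof -
    have "(\<gamma> \<longlongrightarrow> mat 1) (at_right 0)"
      using cont assms(1) by (simp add: isCont_def filterlim_at_split)
    then show ?thesis
      by (rule topological_tendstoD[OF _ open_matrix_exp_strip one_mem_matrix_exp_strip])
  qed
  with assms(3) show "\<forall>\<^sub>F t in at_right 0. matrix_exp (matrix_log (\<gamma> t)) \<in> G"
    by eventually_elim (simp add: matrix_exp_log)
  show "\<forall>\<^sub>F t in at_right 0. (t :: real) > 0"
    by (rule eventually_at_right_less)
  have "((\<lambda>t. matrix_log (\<gamma> t)) has_vector_derivative v) (at 0)"
    using has_derivative_compose[OF assms(2)[unfolded has_vector_derivative_def], of matrix_log "\<lambda>V. V"]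
      has_derivative_matrix_log_one assms(1) by (simp add: has_vector_derivative_def)
  then have "((\<lambda>t. matrix_log (\<gamma> t)) has_vector_derivative v) (at_right 0)"
    by (rule has_vector_derivative_at_within)
  then have "((\<lambda>t. (1 / norm t) *\<^sub>R (matrix_log (\<gamma> t) - t *\<^sub>R v)) \<longlongrightarrow> 0) (at_right 0)"
    by (simp add: has_vector_derivative_def has_derivative_within assms(1) matrix_log_one)
  then have "((\<lambda>t. matrix_log (\<gamma> t) /\<^sub>R t - v) \<longlongrightarrow> 0) (at_right 0)"
  proof (rule Lim_transform_eventually)
    show "\<forall>\<^sub>F t in at_right 0. (1 / norm t) *\<^sub>R (matrix_log (\<gamma> t) - t *\<^sub>R v) = matrix_log (\<gamma> t) /\<^sub>R t - v"
      using eventually_at_right_less[of "0 :: real"]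
      by eventually_elim (simp add: scaleR_diff_right divide_inverse)
  qed
  then show "((\<lambda>t. matrix_log (\<gamma> t) /\<^sub>R t) \<longlongrightarrow> v) (at_right 0)"
    by (rule LIM_zero_cancel)
qed (rule tendsto_ident_at)

lemma lie_algebra_eq_generators: "lie_algebra G = generators G"
proof (intro equalityI subsetI)
  fix v
  assume "v \<in> lie_algebra G"
  then obtain \<gamma> \<epsilon> where \<gamma>: "\<epsilon> > 0" "\<gamma> ` {-\<epsilon><..<\<epsilon>} \<subseteq> G" "\<gamma> (0 :: real) = mat 1"
    "(\<gamma> has_vector_derivative v) (at 0)"
    unfolding lie_algebra_def tangent_space_def by blast
  have "\<forall>\<^sub>F t in at_right 0. t \<in> {0<..<\<epsilon>}"
    by (rule eventually_at_rightI[OF _ \<gamma>(1)])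
  then have "\<forall>\<^sub>F t in at_right 0. \<gamma> t \<in> G"
    by eventually_elim (use \<gamma>(1,2) in auto)
  with \<gamma> show "v \<in> generators G"
    by (intro generatorsI_curve)
next
  fix v
  assume v: "v \<in> generators G"
  have "smooth_on {-1<..<1} (\<lambda>t :: real. matrix_exp (t *\<^sub>R v))"
    unfolding smooth_on_def
    by (intro allI Ck_on_compose[OF _ open_UNIV _ Ck_on_matrix_exp] Ck_on_bounded_linear
        bounded_linear_scaleR_left) auto
  moreover have "((\<lambda>t :: real. matrix_exp (t *\<^sub>R v)) has_vector_derivative v) (at 0)"
    using has_vector_derivative_matrix_exp[of v 0] by simp
  ultimately show "v \<in> lie_algebra G"
    unfolding lie_algebra_def tangent_space_def
    using v by (auto simp: generators_def intro!: exI[of _ "\<lambda>t. matrix_exp (t *\<^sub>R v)"] exI[of _ 1])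
qed

text \<open>For sums, the product of the two one-parameter groups is a curve in \<open>G\<close>
  through the identity with velocity \<open>v + w\<close>.\<close>

lemma subspace_generators: "subspace (generators G)"
  unfolding subspace_def
proof (intro conjI ballI allI)
  show "0 \<in> generators G"
    by (simp add: generators_def closed_subgroup_one)
  show "c *\<^sub>R v \<in> generators G" if "v \<in> generators G" for c v
    using that by (simp add: generators_def)
  fix v w
  assume vw: "v \<in> generators G" "w \<in> generators G"
  show "v + w \<in> generators G"
  proof (rule generatorsI_curve)
    show "((\<lambda>t. matrix_exp (t *\<^sub>R v) ** matrix_exp (t *\<^sub>R w)) has_vector_derivative v + w) (at 0)"
      using bounded_bilinear.has_vector_derivative[OF matrix_mult.bounded_bilinear_axioms
          has_vector_derivative_matrix_exp[of v 0] has_vector_derivative_matrix_exp[of w 0]]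
      by (simp add: add.commute)
  qed (use vw in \<open>auto simp: generators_def closed_subgroup_mult\<close>)
qed

text \<open>Otherwise there are nonzero \<open>Y n\<close> tending to 0, orthogonal to the
  generators, with exponentials in \<open>G\<close>. A limit of their directions is a generator by
  \<open>generatorsI_limit\<close>, yet it is a unit vector orthogonal to all generators, itself
  included.\<close>

lemma matrix_exp_orthogonal_mem_imp_zero:
  obtains \<delta> where "\<delta> > 0"
    "\<And>Y. (\<And>x. x \<in> generators G \<Longrightarrow> Y \<bullet> x = 0) \<Longrightarrow> norm Y < \<delta> \<Longrightarrow> matrix_exp Y \<in> G \<Longrightarrow> Y = 0"
proof (rule ccontr)
  assume "\<not> thesis"
  with that have "\<exists>Y. (\<forall>x\<in>generators G. Y \<bullet> x = 0) \<and> norm Y < \<delta> \<and> matrix_exp Y \<in> G \<and> Y \<noteq> 0"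
    if "\<delta> > 0" for \<delta>
    using that by metis
  then have "\<exists>Y. (\<forall>x\<in>generators G. Y \<bullet> x = 0) \<and> norm Y < inverse (real (Suc n)) \<and> matrix_exp Y \<in> G \<and> Y \<noteq> 0"
    for n
    by simp
  then obtain Y where Y: "\<And>n x. x \<in> generators G \<Longrightarrow> Y n \<bullet> x = 0"
    "\<And>n. norm (Y n) < inverse (real (Suc n))" "\<And>n. matrix_exp (Y n) \<in> G" "\<And>n. Y n \<noteq> 0"
    by metis
  have "seq_compact (sphere 0 1 :: (complex^'n^'n) set)"
    by (intro compact_imp_seq_compact compact_sphere)
  moreover have "\<forall>n. Y n /\<^sub>R norm (Y n) \<in> sphere 0 1"
    using Y(4) by simp
  ultimately obtain y r where y: "y \<in> sphere 0 1" and r: "strict_mono r"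
    and lim: "((\<lambda>n. Y n /\<^sub>R norm (Y n)) \<circ> r) \<longlonglongrightarrow> y"
    by (rule seq_compactE)
  have "(\<lambda>n. norm (Y n)) \<longlonglongrightarrow> 0"
    by (rule Lim_null_comparison[OF _ LIMSEQ_inverse_real_of_nat])
      (use Y(2) in \<open>auto intro: always_eventually less_imp_le\<close>)
  from LIMSEQ_subseq_LIMSEQ[OF this r] have "(\<lambda>n. norm (Y (r n))) \<longlonglongrightarrow> 0"
    by (simp add: o_def)
  then have "y \<in> generators G"
    using lim Y by (intro generatorsI_limit[of sequentially "\<lambda>n. Y (r n)" "\<lambda>n. norm (Y (r n))"])
      (simp_all add: o_def)
  have "(\<lambda>n. ((\<lambda>n. Y n /\<^sub>R norm (Y n)) \<circ> r) n \<bullet> y) \<longlonglongrightarrow> y \<bullet> y"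
    by (intro tendsto_intros lim)
  moreover have "(\<lambda>n. ((\<lambda>n. Y n /\<^sub>R norm (Y n)) \<circ> r) n \<bullet> y) = (\<lambda>n. 0)"
    using Y(1)[OF \<open>y \<in> generators G\<close>] by simp
  ultimately have "y \<bullet> y = 0"
    by (simp only: LIMSEQ_const_iff)
  with y show False
    by simp
qed

text \<open>Every element of \<open>G\<close> near the identity has a logarithm in the Lie algebra.
  The radius \<open>\<delta>\<close> lets these exponents be kept inside the strip later.\<close>

lemma matrix_exp_generators_neighbourhood:
  assumes "\<delta> > 0"
  obtains N where "open N" "mat 1 \<in> N" "G \<inter> N \<subseteq> matrix_exp ` (generators G \<inter> ball 0 \<delta>)"
proof -
  obtain B where B: "B \<subseteq> generators G" "pairwise orthogonal B" "\<And>x. x \<in> B \<Longrightarrow> norm x = 1"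
    "independent B" "span B = generators G"
    using orthonormal_basis_subspace[OF subspace_generators] by metis
  have "finite B"
    using B(4) by (rule independent_imp_finite)
  \<comment> \<open>Orthogonal projection onto the generators, written in an orthonormal
    basis.\<close>
  define P where "P M = (\<Sum>b\<in>B. (M \<bullet> b) *\<^sub>R b)" for M
  have P_mem: "P M \<in> generators G" for M
    unfolding P_def using B(1) subspace_generators by (intro subspace_sum subspace_mul) auto
  have P_lin: "bounded_linear P"
    unfolding P_def
    by (intro bounded_linear_sum bounded_linear_scaleR_const bounded_linear_inner_left)
  have P_orth: "(M - P M) \<bullet> x = 0" if "x \<in> generators G" for M x
  proof -
    have "orthogonal (M - P M) b" if b: "b \<in> B" for b
    proof -
      have "P M \<bullet> b = (\<Sum>c\<in>B. (M \<bullet> c) * (c \<bullet> b))"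
        by (simp add: P_def inner_sum_left)
      also have "\<dots> = (\<Sum>c\<in>{b}. (M \<bullet> c) * (c \<bullet> b))"
        using B(2) b \<open>finite B\<close>
        by (intro sum.mono_neutral_right) (auto simp: pairwise_def orthogonal_def)
      also have "\<dots> = M \<bullet> b"
        using B(3)[OF b] by (simp add: norm_eq_1)
      finally show ?thesis
        by (simp add: orthogonal_def inner_diff_left)
    qed
    then show ?thesis
      using orthogonal_to_span[of x B "M - P M"] that B(5) by (simp add: orthogonal_def)
  qed
  have P0: "P 0 = 0"
    by (simp add: P_def)
  obtain \<epsilon> where \<epsilon>: "\<epsilon> > 0" "\<And>Y. (\<And>x. x \<in> generators G \<Longrightarrow> Y \<bullet> x = 0) \<Longrightarrow> norm Y < \<epsilon> \<Longrightarrow>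
      matrix_exp Y \<in> G \<Longrightarrow> Y = 0"
    using matrix_exp_orthogonal_mem_imp_zero by blast
  define f where "f M = matrix_exp (P M) ** matrix_exp (M - P M)" for M
  \<comment> \<open>The first bound puts the exponent \<open>P M\<close> into the required ball; the
    second makes the orthogonal exponent small enough for the preceding lemma.\<close>
  define T where "T = {M. norm (P M) < \<delta> \<and> norm (M - P M) < \<epsilon>}"
  have contP: "continuous_on UNIV P"
    by (rule linear_continuous_on[OF P_lin])
  have "open T"
    unfolding T_def by (intro open_Collect_conj open_Collect_less continuous_intros contP)
  have contf: "continuous_on UNIV f"
    unfolding f_def by (intro continuous_intros contP)
  \<comment> \<open>Openness of \<open>f\<close> at \<open>0\<close> shows that the elements of \<open>G\<close> near the identity factor as
    \<open>f M = exp (P M) exp (M - P M)\<close>; the second factor then lies in \<open>G\<close> and is trivial.\<close>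
  have derf: "(f has_derivative id) (at 0)"
  proof -
    have P: "(P has_derivative P) (at 0)"
      by (rule bounded_linear_imp_has_derivative[OF P_lin])
    have exp: "((\<lambda>M. matrix_exp (g M)) has_derivative g') (at 0)"
      if "(g has_derivative g') (at 0)" "g 0 = 0" for g g' :: "complex^'n^'n \<Rightarrow> complex^'n^'n"
      using has_derivative_compose[OF that(1), of matrix_exp "\<lambda>V. V"] that(2)
        has_derivative_matrix_exp_zero by simp
    have "(f has_derivative
        (\<lambda>V. matrix_exp (P 0) ** (V - P V) + P V ** matrix_exp (0 - P 0))) (at 0)"
      unfolding f_def
      by (rule bounded_bilinear.FDERIV[OF matrix_mult.bounded_bilinear_axioms exp[OF P]
            exp[OF has_derivative_diff[OF has_derivative_ident P]]]) (simp_all add: P0)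
    then show ?thesis
      by (simp add: P0 id_def)
  qed
  \<comment> \<open>This open mapping theorem asks for continuity of \<open>f\<close> and a right
    inverse of its derivative at the single point 0; here the derivative is the identity.\<close>
  have "f 0 \<in> interior (f ` T)"
    by (rule sussmann_open_mapping[OF open_UNIV contf _ derf bounded_linear_ident[folded id_def]])
      (use \<open>open T\<close> \<epsilon>(1) assms in \<open>auto simp: interior_open T_def P0\<close>)
  then have "mat 1 \<in> interior (f ` T)"
    by (simp add: f_def P0)
  moreover have "G \<inter> interior (f ` T) \<subseteq> matrix_exp ` (generators G \<inter> ball 0 \<delta>)"
  proof
    fix Q
    assume Q: "Q \<in> G \<inter> interior (f ` T)"
    then obtain M where M: "M \<in> T" "Q = f M"
      using interior_subset by blast
    have "matrix_exp (- P M) ** Q = matrix_exp (M - P M)"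
      by (simp add: M(2) f_def matrix_mul_assoc matrix_exp_minus)
    then have "matrix_exp (M - P M) \<in> G"
      using closed_subgroup_mult[OF matrix_exp_minus_mem[OF matrix_exp_mem[OF P_mem[of M]]], of Q] Q by simp
    with M(1) have "M - P M = 0"
      by (intro \<epsilon>(2)[OF P_orth]) (simp_all add: T_def)
    then have "Q = matrix_exp (P M)"
      by (simp add: M(2) f_def)
    then show "Q \<in> matrix_exp ` (generators G \<inter> ball 0 \<delta>)"
      using P_mem[of M] M(1) by (auto simp: T_def)
  qed
  ultimately show ?thesis
    using that open_interior by blast
qed

text \<open>Left translation by \<open>matrix_exp (- A)\<close> moves \<open>Q\<close> to the
  identity, where elements of \<open>G\<close> have logarithms in the Lie algebra. An open part of
  the Lie algebra around \<open>A\<close> is thereby mapped injectively into the Lie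
  algebra.\<close>

lemma openin_matrix_exp_image:
  "openin (top_of_set G) (matrix_exp ` (generators G \<inter> strip))"
proof (subst openin_subopen, intro ballI)
  fix Q
  assume "Q \<in> matrix_exp ` (generators G \<inter> strip)"
  then obtain A where A: "A \<in> generators G" "A \<in> strip" and Q: "Q = matrix_exp A"
    by blast
  have exp_A: "matrix_exp (- A) \<in> G"
    by (rule matrix_exp_minus_mem[OF matrix_exp_mem[OF A(1)]])
  obtain \<delta> where \<delta>: "\<delta> > 0" "ball 0 \<delta> \<subseteq> (strip :: (complex^'n^'n) set)"
    using open_strip zero_mem_strip openE by blast
  obtain N' where N': "open N'" "mat 1 \<in> N'" "G \<inter> N' \<subseteq> matrix_exp ` (generators G \<inter> ball 0 \<delta>)"
    using matrix_exp_generators_neighbourhood[OF \<delta>(1)] .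
  \<comment> \<open>Intersecting with the image of the strip keeps \<open>matrix_log\<close>
    continuous on \<open>N\<close>.\<close>
  define N where "N = N' \<inter> matrix_exp ` strip"
  have N: "open N" "mat 1 \<in> N"
    using N' open_matrix_exp_strip one_mem_matrix_exp_strip by (auto simp: N_def)
  have log_mem: "matrix_log B \<in> generators G" "matrix_exp (matrix_log B) = B" if "B \<in> G \<inter> N" for B
  proof -
    obtain X where "X \<in> generators G" "X \<in> ball 0 \<delta>" "B = matrix_exp X"
      using \<open>B \<in> G \<inter> N\<close> N'(3) unfolding N_def by blast
    then show "matrix_log B \<in> generators G" "matrix_exp (matrix_log B) = B"
      using matrix_log_exp[of X] \<delta>(2) by auto
  qed
  have cont_log: "continuous_on N matrix_log"
    using Ck_on_imp_continuous_on[OF Ck_on_matrix_log]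
    by (rule continuous_on_subset) (simp add: N_def)
  define S where "S = generators G \<inter> (strip \<inter> (\<lambda>X. matrix_exp (- A) ** matrix_exp X) -` N)"
  define f where "f X = matrix_log (matrix_exp (- A) ** matrix_exp X)" for X
  have S_N: "matrix_exp (- A) ** matrix_exp X \<in> G \<inter> N" if "X \<in> S" for X
    using that exp_A by (auto simp: S_def intro!: closed_subgroup_mult matrix_exp_mem)
  have A_S: "A \<in> S"
    using A N(2) by (simp add: S_def matrix_exp_minus)
  have "open ((\<lambda>X. matrix_exp (- A) ** matrix_exp X) -` N)"
    by (rule open_vimage[OF N(1)]) (intro continuous_intros)
  then have "openin (top_of_set (generators G)) S"
    unfolding S_def by (intro openin_open_Int open_Int open_strip)
  moreover have "continuous_on S f"
    unfolding f_def
    by (rule continuous_on_compose2[OF cont_log]) (use S_N in \<open>auto intro!: continuous_intros\<close>)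
  moreover have "f \<in> S \<rightarrow> generators G"
    using S_N log_mem(1) by (auto simp: f_def)
  moreover have inj_f: "inj_on f S"
  proof (rule inj_onI)
    fix X Y
    assume XY: "X \<in> S" "Y \<in> S" "f X = f Y"
    then have "matrix_exp (- A) ** matrix_exp X = matrix_exp (- A) ** matrix_exp Y"
      using S_N log_mem(2) unfolding f_def by metis
    then have "matrix_exp X = matrix_exp Y"
      by (metis matrix_exp_minus(1) matrix_mul_assoc matrix_mul_lid)
    then show "X = Y"
      using XY inj_on_matrix_exp by (auto simp: S_def inj_on_def)
  qed
  \<comment> \<open>Invariance of domain makes it unnecessary to compute the differential of the exponential at \<open>A\<close>.\<close>
  ultimately have "openin (top_of_set (generators G)) (f ` S)"
    by (intro invariance_of_domain_subspaces[OF _ subspace_generators subspace_generators]) auto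
  then obtain T where T: "open T" "f ` S = generators G \<inter> T"
    by (auto simp: openin_open)
  define W where "W = (\<lambda>B. matrix_exp (- A) ** B) -` (N \<inter> matrix_log -` T)"
  have "open (N \<inter> matrix_log -` T)"
    using cont_log N(1) T(1) by (simp add: continuous_on_open_vimage Int_commute)
  then have "open W"
    unfolding W_def by (rule open_vimage) (intro continuous_intros)
  moreover have "Q \<in> W"
  proof -
    have "f A \<in> T"
      using A_S T(2) by auto
    then show ?thesis
      using N(2) by (simp add: W_def Q f_def matrix_exp_minus)
  qed
  moreover have "G \<inter> W \<subseteq> matrix_exp ` (generators G \<inter> strip)"
  proof
    fix B
    assume B: "B \<in> G \<inter> W"
    let ?C = "matrix_exp (- A) ** B"
    have C: "?C \<in> G \<inter> N" "matrix_log ?C \<in> T"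
      using B exp_A by (auto simp: W_def intro!: closed_subgroup_mult)
    then have "matrix_log ?C \<in> f ` S"
      using log_mem(1) T(2) by auto
    then obtain X where X: "X \<in> S" "matrix_log ?C = f X"
      by auto
    have "?C = matrix_exp (matrix_log ?C)"
      by (simp only: log_mem(2)[OF C(1)])
    also have "\<dots> = matrix_exp (- A) ** matrix_exp X"
      by (simp only: X(2) f_def log_mem(2)[OF S_N[OF X(1)]])
    finally have "B = matrix_exp X"
      by (metis matrix_exp_minus(1) matrix_mul_assoc matrix_mul_lid)
    then show "B \<in> matrix_exp ` (generators G \<inter> strip)"
      using X(1) by (auto simp: S_def)
  qed
  moreover have "Q \<in> G"
    using A(1) matrix_exp_mem Q by simp
  ultimately show "\<exists>V. openin (top_of_set G) V \<and> Q \<in> V \<and> V \<subseteq> matrix_exp ` (generators G \<inter> strip)"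
    by (intro exI[of _ "G \<inter> W"]) (auto simp: openin_open_Int)
qed

end

theorem theoremC2:
  fixes G U :: "(complex^'n^'n) set"
  assumes "closed_subgroup_GL G"
    and "U = {A \<in> lie_algebra G. \<forall>\<mu>. eigenvalue A \<mu> \<longrightarrow> \<bar>Im \<mu>\<bar> < pi}"
  shows "matrix_exp ` lie_algebra G \<subseteq> G \<and>
    openin (top_of_set (lie_algebra G)) U \<and>
    openin (top_of_set G) (matrix_exp ` U) \<and>
    diffeomorphism_between U (matrix_exp ` U) matrix_exp"
proof (intro conjI)
  note lie = lie_algebra_eq_generators[OF assms(1)]
  have U: "U = lie_algebra G \<inter> strip"
    using assms(2) by (auto simp: strip_def)
  show "matrix_exp ` lie_algebra G \<subseteq> G"
    unfolding lie using matrix_exp_mem[OF assms(1)] by blast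
  show "openin (top_of_set (lie_algebra G)) U"
    unfolding U by (intro openin_open_Int open_strip)
  show "openin (top_of_set G) (matrix_exp ` U)"
    unfolding U lie by (rule openin_matrix_exp_image[OF assms(1)])
  have inj: "inj_on matrix_exp U"
    using inj_on_matrix_exp by (rule inj_on_subset) (simp add: U)
  have "smooth_map_on U matrix_exp"
    unfolding smooth_map_on_def
    by (intro ballI exI[of _ UNIV] exI[of _ matrix_exp]) (simp add: smooth_on_def Ck_on_matrix_exp)
  moreover have "smooth_map_on (matrix_exp ` U) (inv_into U matrix_exp)"
    unfolding smooth_map_on_def
  proof (intro ballI exI conjI)
    show "smooth_on (matrix_exp ` strip :: (complex^'n^'n) set) matrix_log"
      by (simp add: smooth_on_def Ck_on_matrix_log)
    fix B
    assume "B \<in> matrix_exp ` U"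
    then show "B \<in> matrix_exp ` strip"
      by (auto simp: U)
    fix C
    assume "C \<in> matrix_exp ` U \<inter> matrix_exp ` strip"
    then obtain A where "A \<in> U" "C = matrix_exp A"
      by blast
    moreover from this have "A \<in> strip"
      by (simp add: U)
    ultimately show "matrix_log C = inv_into U matrix_exp C"
      by (simp only: inv_into_f_f[OF inj] matrix_log_exp)
  qed (rule open_matrix_exp_strip)
  ultimately show "diffeomorphism_between U (matrix_exp ` U) matrix_exp"
    by (simp add: diffeomorphism_between_def inj_on_imp_bij_betw[OF inj])
qed

end
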